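(* Let $\mathcal{C}=((J_0,U_0),\ldots,(J_\ell,U_\ell))$ be an idealistic chain in a commutative ring $R$. It collapses if and only if the idealistic chain $((\widetilde{J_0},\widetilde{U_0}),\ldots,(\widetilde{J_\ell},\widetilde{U_\ell}))$ collapses in the distributive lattice $\mathrm{Zar}(R)$. For instance, if $\mathcal{C}$ is finite (all $J_i,U_i$ finite), the following properties are equivalent: 1. there exist $j_i\in\langle J_i\rangle$, $u_i\in\mathcal{M}(U_i)$ $(i=0,\ldots,\ell)$ such that $$u_0\cdot(u_1\cdot(\cdots(u_\ell+j_\ell)+\cdots)+j_1)+j_0=0;$$ 2. there exist $x_1,\ldots,x_\ell\in\mathrm{Zar}(R)$ such that in $\mathrm{Zar}(R)$: $$\begin{array}{rcl} x_1,\;\widetilde{U_0}&\vdash&\widetilde{J_0}\\ x_2,\;\widetilde{U_1}&\vdash&\widetilde{J_1},\;x_1\\ &\vdots&\\ x_\ell,\;\widetilde{U_{\ell-1}}&\vdash&\widetilde{J_{\ell-1}},\;x_{\ell-1}\\ \widetilde{U_\ell}&\vdash&\widetilde{J_\ell},\;x_\ell \end{array}$$ 3. the same as 2, but with $x_1,\ldots,x_\ell\in\widetilde{R}=\{\widetilde{a}: a\in R\}$.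
   Context: For $J,U\subseteq R$, $\langle J\rangle$ is the ideal generated by $J$ and $\mathcal{M}(U)$ the multiplicative monoid (containing $1$) generated by $U$. An idealistic chain of length $\ell$ in a ring (or in a distributive lattice) is a list of $\ell+1$ pairs $(J_i,U_i)$ of subsets of it. In a ring $R$ it collapses if there exist $j_i\in\langle J_i\rangle$, $u_i\in\mathcal{M}(U_i)$ with $u_0(u_1(\cdots(u_\ell+j_\ell)+\cdots)+j_1)+j_0=0$. $\mathrm{Zar}(R)$, the Zariski lattice of $R$, is the set of radicals of finitely generated ideals of $R$, ordered by inclusion; it is a distributive lattice with $\sqrt{I_1}\wedge\sqrt{I_2}=\sqrt{I_1I_2}$ and $\sqrt{I_1}\vee\sqrt{I_2}=\sqrt{I_1+I_2}$. For $a\in R$, $\widetilde a=\sqrt{\langle a\rangle}$, and for $S\subseteq R$, $\widetilde S=\{\widetilde s: s\in S\}$. In a distributive lattice $T$ (with $0,1$): for finite $A,B\subseteq T$, $A\vdash B$ means $\bigwedge A\le\bigvee B$ (with $x$ standing for $\{x\}$ and commas for unions). An ideal $I$ and a filter $F$ of $T$ are conjugate if ($f\in F$, $x\wedge f\in I$ imply $x\in I$) and ($j\in I$, $x\vee j\in F$ imply $x\in F$). A chain $((J_i,U_i))_i$ in $T$ is saturated if each $J_i$ is an ideal, each $U_i$ is a filter, $J_i$ and $U_i$ are conjugate, $J_i\subseteq J_{i+1}$ and $U_{i+1}\subseteq U_i$. A chain $\mathcal{C}'$ refines $\mathcal{C}$ if $J_i\subseteq J'_i$ and $U_i\subseteq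 U'_i$ for all $i$. A chain in $T$ collapses if the only saturated chain refining it is the trivial chain $((T,T),\ldots,(T,T))$. *)

theory Defs
  imports "HOL-Algebra.Algebra"
begin

text \<open>A chain of length \<open>l\<close> is given by two families \<open>J, U\<close> of sets indexed by the naturals, of
  which only the members with index \<open>i \<le> l\<close> are ever inspected.\<close>

definition idealistic_chain ::
    "('a, 'm) partial_object_scheme \<Rightarrow> nat \<Rightarrow> (nat \<Rightarrow> 'a set) \<Rightarrow> (nat \<Rightarrow> 'a set) \<Rightarrow> bool" where
  "idealistic_chain S l J U \<longleftrightarrow> (\<forall>i\<le>l. J i \<subseteq> carrier S \<and> U i \<subseteq> carrier S)"


section \<open>Collapse in a ring\<close>

definition gen_submonoid :: "('a, 'm) monoid_scheme \<Rightarrow> 'a set \<Rightarrow> 'a set" where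
  "gen_submonoid G S = \<Inter>{H. submonoid H G \<and> S \<subseteq> H}"

text \<open>\<open>chain_expr R l j u\<close> is \<open>u 0 (u 1 (\<dots> (u l + j l) \<dots>) + j 1) + j 0\<close>.\<close>

fun chain_expr :: "('a, 'm) ring_scheme \<Rightarrow> nat \<Rightarrow> (nat \<Rightarrow> 'a) \<Rightarrow> (nat \<Rightarrow> 'a) \<Rightarrow> 'a" where
  "chain_expr R 0 j u = u 0 \<oplus>\<^bsub>R\<^esub> j 0"
| "chain_expr R (Suc l) j u =
     u 0 \<otimes>\<^bsub>R\<^esub> chain_expr R l (\<lambda>i. j (Suc i)) (\<lambda>i. u (Suc i)) \<oplus>\<^bsub>R\<^esub> j 0"

definition ring_collapses ::
    "('a, 'm) ring_scheme \<Rightarrow> nat \<Rightarrow> (nat \<Rightarrow> 'a set) \<Rightarrow> (nat \<Rightarrow> 'a set) \<Rightarrow> bool" where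
  "ring_collapses R l J U \<longleftrightarrow>
     (\<exists>j u. (\<forall>i\<le>l. j i \<in> Idl\<^bsub>R\<^esub> (J i) \<and> u i \<in> gen_submonoid R (U i)) \<and>
            chain_expr R l j u = \<zero>\<^bsub>R\<^esub>)"


section \<open>Collapse in a distributive lattice\<close>

definition lat_ideal :: "('a, 'm) gorder_scheme \<Rightarrow> 'a set \<Rightarrow> bool" where
  "lat_ideal T I \<longleftrightarrow> I \<subseteq> carrier T \<and> \<bottom>\<^bsub>T\<^esub> \<in> I \<and>
     (\<forall>x\<in>I. \<forall>y\<in>I. x \<squnion>\<^bsub>T\<^esub> y \<in> I) \<and>
     (\<forall>x\<in>I. \<forall>z\<in>carrier T. x \<sqinter>\<^bsub>T\<^esub> z \<in> I)"

definition lat_filter :: "('a, 'm) gorder_scheme \<Rightarrow> 'a set \<Rightarrow> bool" where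
  "lat_filter T F \<longleftrightarrow> F \<subseteq> carrier T \<and> \<top>\<^bsub>T\<^esub> \<in> F \<and>
     (\<forall>x\<in>F. \<forall>y\<in>F. x \<sqinter>\<^bsub>T\<^esub> y \<in> F) \<and>
     (\<forall>x\<in>F. \<forall>z\<in>carrier T. x \<squnion>\<^bsub>T\<^esub> z \<in> F)"

definition conjugate :: "('a, 'm) gorder_scheme \<Rightarrow> 'a set \<Rightarrow> 'a set \<Rightarrow> bool" where
  "conjugate T I F \<longleftrightarrow>
     (\<forall>x\<in>carrier T. \<forall>f\<in>F. x \<sqinter>\<^bsub>T\<^esub> f \<in> I \<longrightarrow> x \<in> I) \<and>
     (\<forall>x\<in>carrier T. \<forall>j\<in>I. x \<squnion>\<^bsub>T\<^esub> j \<in> F \<longrightarrow> x \<in> F)"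

definition saturated ::
    "('a, 'm) gorder_scheme \<Rightarrow> nat \<Rightarrow> (nat \<Rightarrow> 'a set) \<Rightarrow> (nat \<Rightarrow> 'a set) \<Rightarrow> bool" where
  "saturated T l J U \<longleftrightarrow>
     (\<forall>i\<le>l. lat_ideal T (J i) \<and> lat_filter T (U i) \<and> conjugate T (J i) (U i)) \<and>
     (\<forall>i<l. J i \<subseteq> J (Suc i) \<and> U (Suc i) \<subseteq> U i)"

definition refines ::
    "nat \<Rightarrow> (nat \<Rightarrow> 'a set) \<Rightarrow> (nat \<Rightarrow> 'a set) \<Rightarrow> (nat \<Rightarrow> 'a set) \<Rightarrow> (nat \<Rightarrow> 'a set) \<Rightarrow> bool" where
  "refines l J' U' J U \<longleftrightarrow> (\<forall>i\<le>l. J i \<subseteq> J' i \<and> U i \<subseteq> U' i)"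

definition lat_collapses ::
    "('a, 'm) gorder_scheme \<Rightarrow> nat \<Rightarrow> (nat \<Rightarrow> 'a set) \<Rightarrow> (nat \<Rightarrow> 'a set) \<Rightarrow> bool" where
  "lat_collapses T l J U \<longleftrightarrow>
     (\<forall>J' U'. saturated T l J' U' \<and> refines l J' U' J U \<longrightarrow>
        (\<forall>i\<le>l. J' i = carrier T \<and> U' i = carrier T))"

text \<open>Meant for finite \<open>A\<close> and \<open>B\<close>; an empty meet is \<open>\<top>\<close> and an empty join is \<open>\<bottom>\<close>.\<close>

definition entails :: "('a, 'm) gorder_scheme \<Rightarrow> 'a set \<Rightarrow> 'a set \<Rightarrow> bool" where
  "entails T A B \<longleftrightarrow> \<Sqinter>\<^bsub>T\<^esub>A \<sqsubseteq>\<^bsub>T\<^esub> \<Squnion>\<^bsub>T\<^esub>B"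

text \<open>The system \<open>x (i+1), U i \<turnstile> J i, x i\<close> for \<open>i = 0, \<dots>, l\<close>, where \<open>x 0\<close> and
  \<open>x (l+1)\<close> are left out, so that only \<open>x 1, \<dots>, x l\<close> occur.\<close>

definition entailment_system ::
    "('a, 'm) gorder_scheme \<Rightarrow> nat \<Rightarrow> (nat \<Rightarrow> 'a set) \<Rightarrow> (nat \<Rightarrow> 'a set) \<Rightarrow> (nat \<Rightarrow> 'a) \<Rightarrow> bool" where
  "entailment_system T l J U x \<longleftrightarrow>
     (\<forall>i\<le>l. entails T ((if i < l then {x (Suc i)} else {}) \<union> U i)
                       (J i \<union> (if 0 < i then {x i} else {})))"


section \<open>The Zariski lattice\<close>

definition radical :: "('a, 'm) ring_scheme \<Rightarrow> 'a set \<Rightarrow> 'a set" where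
  "radical R I = {x \<in> carrier R. \<exists>n::nat. x [^]\<^bsub>R\<^esub> n \<in> I}"

definition Zar :: "('a, 'm) ring_scheme \<Rightarrow> 'a set gorder" where
  "Zar R = \<lparr>carrier = {radical R (Idl\<^bsub>R\<^esub> S) | S. finite S \<and> S \<subseteq> carrier R},
            eq = (=), le = (\<subseteq>)\<rparr>"

definition zar_of :: "('a, 'm) ring_scheme \<Rightarrow> 'a \<Rightarrow> 'a set" where
  "zar_of R a = radical R (Idl\<^bsub>R\<^esub> {a})"


subsection \<open>It is a bounded lattice with the expected operations\<close>

lemma Zar_simps [simp]:
  "carrier (Zar R) = {radical R (Idl\<^bsub>R\<^esub> S) | S. finite S \<and> S \<subseteq> carrier R}"
  "eq (Zar R) = (=)" "le (Zar R) = (\<subseteq>)"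
  by (simp_all add: Zar_def)

context cring
begin

lemma radical_increasing:
  assumes "I \<subseteq> carrier R"
  shows "I \<subseteq> radical R I"
proof
  fix x assume "x \<in> I"
  with assms have "x \<in> carrier R" "x [^] (1::nat) \<in> I" by auto
  then show "x \<in> radical R I" unfolding radical_def by blast
qed

lemma radical_mono: "I \<subseteq> K \<Longrightarrow> radical R I \<subseteq> radical R K"
  by (auto simp: radical_def)

lemma radical_idem: "radical R (radical R I) \<subseteq> radical R I"
  by (auto simp: radical_def nat_pow_pow)

lemma radical_add_aux:
  assumes K: "ideal K R" and "x \<in> carrier R" "y \<in> carrier R" "a \<in> carrier R"
    and "x [^] n \<otimes> a \<in> K" "y [^] m \<otimes> a \<in> K"
  shows "(x \<oplus> y) [^] (n + m :: nat) \<otimes> a \<in> K"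
  using assms(4-6)
proof (induction "n + m" arbitrary: n m a)
  case 0
  then show ?case by simp
next
  case (Suc k)
  note xy = assms(2,3) and a = \<open>a \<in> carrier R\<close>
  have cl: "z \<otimes> w \<in> K" if "w \<in> K" "z \<in> carrier R" for z w
    using ideal.I_l_closed[OF K] that by blast
  show ?case
  proof (cases "n = 0 \<or> m = 0")
    case True
    then have "a \<in> K" using Suc.prems by auto
    then show ?thesis using cl xy by simp
  next
    case False
    then obtain n' m' where n: "n = Suc n'" and m: "m = Suc m'"
      by (meson not0_implies_Suc)
    have "x [^] n' \<otimes> (x \<otimes> a) \<in> K" "y [^] m' \<otimes> (y \<otimes> a) \<in> K"
      using Suc.prems(2,3) xy a by (simp_all add: n m m_assoc)
    moreover have "y [^] m \<otimes> (x \<otimes> a) = x \<otimes> (y [^] m \<otimes> a)"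
      "x [^] n \<otimes> (y \<otimes> a) = y \<otimes> (x [^] n \<otimes> a)"
      using xy a by (simp_all add: m_lcomm)
    moreover have "k = n' + m" "k = n + m'" using Suc.hyps(2) n m by auto
    ultimately have "(x \<oplus> y) [^] k \<otimes> (x \<otimes> a) \<in> K" "(x \<oplus> y) [^] k \<otimes> (y \<otimes> a) \<in> K"
      using Suc.hyps(1)[of n' m "x \<otimes> a"] Suc.hyps(1)[of n m' "y \<otimes> a"] Suc.prems xy cl by auto
    then have "(x \<oplus> y) [^] k \<otimes> (x \<otimes> a) \<oplus> (x \<oplus> y) [^] k \<otimes> (y \<otimes> a) \<in> K"
      by (rule additive_subgroup.a_closed[OF ideal.axioms(1)[OF K]])
    moreover have "(x \<oplus> y) [^] (n + m) \<otimes> a =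
        (x \<oplus> y) [^] k \<otimes> (x \<otimes> a) \<oplus> (x \<oplus> y) [^] k \<otimes> (y \<otimes> a)"
      using xy a Suc.hyps(2)[symmetric] by (simp add: m_assoc l_distr r_distr)
    ultimately show ?thesis by simp
  qed
qed

lemma radical_ideal:
  assumes K: "ideal K R"
  shows "ideal (radical R K) R"
proof (rule idealI)
  interpret K: ideal K R by fact
  have mem: "a \<otimes> x \<in> radical R K" if "a \<in> radical R K" "x \<in> carrier R" for a x
    using that by (auto simp: radical_def nat_pow_distrib intro: K.I_r_closed)
  show "ring R" by (rule ring_axioms)
  show "subgroup (radical R K) (add_monoid R)"
  proof (rule add.subgroupI)
    show "radical R K \<subseteq> carrier R" by (auto simp: radical_def)
    show "radical R K \<noteq> {}"
      using radical_increasing[OF K.a_subset] K.zero_closed by blast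
    show "\<ominus> a \<in> radical R K" if "a \<in> radical R K" for a
    proof -
      have "a \<in> carrier R" using that by (simp add: radical_def)
      then have "\<ominus> a = a \<otimes> (\<ominus> \<one>)" by (simp add: r_minus)
      then show ?thesis using mem[OF that, of "\<ominus> \<one>"] by simp
    qed
    show "a \<oplus> b \<in> radical R K" if "a \<in> radical R K" "b \<in> radical R K" for a b
    proof -
      from that obtain n m :: nat where ab: "a \<in> carrier R" "b \<in> carrier R"
        and "a [^] n \<in> K" "b [^] m \<in> K" by (auto simp: radical_def)
      then have "(a \<oplus> b) [^] (n + m) \<otimes> \<one> \<in> K"
        by (intro radical_add_aux[OF K]) auto
      then show ?thesis using ab by (auto simp: radical_def)
    qed
  qed
  show "x \<otimes> a \<in> radical R K" "a \<otimes> x \<in> radical R K"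
    if "a \<in> radical R K" "x \<in> carrier R" for a x
  proof -
    have "a \<in> carrier R" using that(1) by (simp add: radical_def)
    then show "x \<otimes> a \<in> radical R K" "a \<otimes> x \<in> radical R K"
      using mem[OF that] m_comm[of x a] that(2) by simp_all
  qed
qed

lemma radical_Idl_subset_iff:
  assumes "S \<subseteq> carrier R" "ideal K R"
  shows "radical R (Idl S) \<subseteq> radical R K \<longleftrightarrow> S \<subseteq> radical R K"
proof
  assume "radical R (Idl S) \<subseteq> radical R K"
  moreover have "Idl S \<subseteq> carrier R"
    using genideal_ideal[OF assms(1)] ideal.Icarr by fast
  ultimately show "S \<subseteq> radical R K"
    using genideal_self[OF assms(1)] radical_increasing by blast
next
  assume "S \<subseteq> radical R K"
  then have "Idl S \<subseteq> radical R K"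
    by (rule genideal_minimal[OF radical_ideal[OF assms(2)]])
  then show "radical R (Idl S) \<subseteq> radical R K"
    using radical_mono radical_idem by blast
qed

lemma Idl_mult_subset:
  assumes S: "S \<subseteq> carrier R" and T: "T \<subseteq> carrier R" and K: "ideal K R"
    and st: "\<And>s t. s \<in> S \<Longrightarrow> t \<in> T \<Longrightarrow> s \<otimes> t \<in> K" and "x \<in> Idl S" "y \<in> Idl T"
  shows "x \<otimes> y \<in> K"
proof -
  interpret K: ideal K R by fact
  have quot: "ideal {x \<in> carrier R. \<forall>a\<in>A. x \<otimes> a \<in> K} R" if A: "A \<subseteq> carrier R" for A
  proof (rule idealI)
    show "ring R" by (rule ring_axioms)
    show "subgroup {x \<in> carrier R. \<forall>a\<in>A. x \<otimes> a \<in> K} (add_monoid R)"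
    proof (rule add.subgroupI)
      have "\<zero> \<in> {x \<in> carrier R. \<forall>a\<in>A. x \<otimes> a \<in> K}"
        using A by (auto simp: subset_iff)
      then show "{x \<in> carrier R. \<forall>a\<in>A. x \<otimes> a \<in> K} \<noteq> {}" by blast
    qed (use A in \<open>auto simp: l_distr l_minus subset_iff intro!: K.a_closed K.a_inv_closed\<close>)
  next
    fix a x assume a: "a \<in> {x \<in> carrier R. \<forall>a\<in>A. x \<otimes> a \<in> K}" and x: "x \<in> carrier R"
    have "x \<otimes> a \<otimes> b \<in> K" if "b \<in> A" for b
    proof -
      have "b \<in> carrier R" using that A by blast
      moreover have "x \<otimes> (a \<otimes> b) \<in> K" using a x that by (simp add: K.I_l_closed)
      ultimately show ?thesis using a x by (simp add: m_assoc)
    qed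
    then show "x \<otimes> a \<in> {x \<in> carrier R. \<forall>a\<in>A. x \<otimes> a \<in> K}" using a x by simp
    then show "a \<otimes> x \<in> {x \<in> carrier R. \<forall>a\<in>A. x \<otimes> a \<in> K}"
      using a x m_comm[of x a] by simp
  qed
  have "Idl S \<subseteq> {x \<in> carrier R. \<forall>a\<in>T. x \<otimes> a \<in> K}"
    using S st by (intro genideal_minimal quot[OF T]) auto
  then have x: "x \<in> carrier R" "\<And>t. t \<in> T \<Longrightarrow> x \<otimes> t \<in> K" using assms by auto
  have "Idl T \<subseteq> {y \<in> carrier R. \<forall>a\<in>{x}. y \<otimes> a \<in> K}"
    using T x by (intro genideal_minimal quot) (auto simp: m_comm subset_iff)
  then show ?thesis using assms(6) x(1) by (auto simp: m_comm)
qed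

lemma radical_Idl_Int:
  assumes S: "S \<subseteq> carrier R" and T: "T \<subseteq> carrier R"
  shows "radical R (Idl S) \<inter> radical R (Idl T) = radical R (Idl {s \<otimes> t | s t. s \<in> S \<and> t \<in> T})"
    (is "_ = radical R (Idl ?P)")
proof
  have P: "?P \<subseteq> carrier R" using S T by auto
  show "radical R (Idl S) \<inter> radical R (Idl T) \<subseteq> radical R (Idl ?P)"
  proof
    fix x assume "x \<in> radical R (Idl S) \<inter> radical R (Idl T)"
    then obtain n m :: nat where x: "x \<in> carrier R" "x [^] n \<in> Idl S" "x [^] m \<in> Idl T"
      by (auto simp: radical_def)
    have "s \<otimes> t \<in> Idl ?P" if "s \<in> S" "t \<in> T" for s t
      using that genideal_self[OF P] by blast
    from Idl_mult_subset[OF S T genideal_ideal[OF P] this x(2,3)]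
    have "x [^] n \<otimes> x [^] m \<in> Idl ?P" .
    then have "x [^] (n + m) \<in> Idl ?P"
      using x by (simp add: nat_pow_mult)
    then show "x \<in> radical R (Idl ?P)" using x unfolding radical_def by blast
  qed
  have "s \<otimes> t \<in> Idl S \<inter> Idl T" if "s \<in> S" "t \<in> T" for s t
  proof -
    have "s \<in> carrier R" "t \<in> carrier R" "s \<in> Idl S" "t \<in> Idl T"
      using that S T genideal_self by auto
    then show ?thesis
      using ideal.I_r_closed[OF genideal_ideal[OF S]] ideal.I_l_closed[OF genideal_ideal[OF T]]
      by simp
  qed
  then have "?P \<subseteq> Idl S" "?P \<subseteq> Idl T"
    by blast+
  then have "Idl ?P \<subseteq> Idl S" "Idl ?P \<subseteq> Idl T"
    using genideal_minimal[OF genideal_ideal[OF S]] genideal_minimal[OF genideal_ideal[OF T]]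
    by blast+
  then show "radical R (Idl ?P) \<subseteq> radical R (Idl S) \<inter> radical R (Idl T)"
    by (simp add: radical_mono)
qed

lemma Zar_least:
  assumes "finite S" "finite T" "S \<subseteq> carrier R" "T \<subseteq> carrier R"
  shows "least (Zar R) (radical R (Idl (S \<union> T)))
           (Upper (Zar R) {radical R (Idl S), radical R (Idl T)})"
proof -
  have "radical R (Idl S) \<subseteq> radical R (Idl (S \<union> T))" "radical R (Idl T) \<subseteq> radical R (Idl (S \<union> T))"
    using assms by (simp_all add: radical_mono subset_Idl_subset)
  moreover have "radical R (Idl (S \<union> T)) \<subseteq> w"
    if "w \<in> Upper (Zar R) {radical R (Idl S), radical R (Idl T)}" for w
  proof -
    have "radical R (Idl S) \<in> carrier (Zar R)" "radical R (Idl T) \<in> carrier (Zar R)"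
      unfolding Zar_simps using assms by blast+
    with that have "w \<in> carrier (Zar R)" "radical R (Idl S) \<subseteq> w" "radical R (Idl T) \<subseteq> w"
      by (simp_all add: Upper_def del: Zar_simps(1))
    moreover from this(1) obtain W where "W \<subseteq> carrier R" "w = radical R (Idl W)" by auto
    ultimately show ?thesis
      using assms(3,4) by (simp add: radical_Idl_subset_iff genideal_ideal)
  qed
  moreover have "radical R (Idl (S \<union> T)) \<in> carrier (Zar R)"
    unfolding Zar_simps using assms by blast
  ultimately show ?thesis
    unfolding least_def Zar_simps(3)
  proof (intro conjI ballI)
    show "Upper (Zar R) {radical R (Idl S), radical R (Idl T)} \<subseteq> carrier (Zar R)"
      by (rule Upper_closed)
  qed (auto simp: Upper_def simp del: Zar_simps(1))
qed

lemma Zar_greatest: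
  assumes "finite S" "finite T" "S \<subseteq> carrier R" "T \<subseteq> carrier R"
  shows "greatest (Zar R) (radical R (Idl {s \<otimes> t | s t. s \<in> S \<and> t \<in> T}))
           (Lower (Zar R) {radical R (Idl S), radical R (Idl T)})"
proof -
  let ?P = "{s \<otimes> t | s t. s \<in> S \<and> t \<in> T}"
  have "finite ?P" using assms by (simp add: finite_image_set2)
  moreover have "?P \<subseteq> carrier R" using assms by auto
  ultimately have "radical R (Idl ?P) \<in> carrier (Zar R)"
    unfolding Zar_simps by blast
  moreover have "radical R (Idl S) \<in> carrier (Zar R)" "radical R (Idl T) \<in> carrier (Zar R)"
    unfolding Zar_simps using assms by blast+
  ultimately show ?thesis
    unfolding greatest_def Lower_def radical_Idl_Int[OF assms(3,4), symmetric]
    by (auto simp del: Zar_simps(1))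
qed

lemma Zar_bounded_lattice: "bounded_lattice (Zar R)"
proof -
  have "partial_order (Zar R)"
    by unfold_locales auto
  then interpret partial_order "Zar R" .
  show ?thesis
  proof unfold_locales
    show "\<exists>x. least (Zar R) x (carrier (Zar R))"
    proof
      show "least (Zar R) (radical R (Idl {})) (carrier (Zar R))"
        unfolding least_def Zar_simps
      proof (intro conjI ballI)
        fix w assume "w \<in> {radical R (Idl S) | S. finite S \<and> S \<subseteq> carrier R}"
        then obtain W where "W \<subseteq> carrier R" "w = radical R (Idl W)" by blast
        then show "radical R (Idl {}) \<subseteq> w"
          by (simp add: radical_Idl_subset_iff genideal_ideal)
      qed blast+
    qed
    show "\<exists>x. greatest (Zar R) x (carrier (Zar R))"
    proof
      show "greatest (Zar R) (radical R (Idl {\<one>})) (carrier (Zar R))"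
        unfolding greatest_def Zar_simps
      proof (intro conjI ballI)
        show "radical R (Idl {\<one>}) \<in> {radical R (Idl S) | S. finite S \<and> S \<subseteq> carrier R}"
          by (rule CollectI, rule exI[of _ "{\<one>}"]) simp
        have "radical R (Idl {\<one>}) = carrier R"
          by (auto simp: radical_def genideal_one)
        then show "w \<subseteq> radical R (Idl {\<one>})"
          if "w \<in> {radical R (Idl S) | S. finite S \<and> S \<subseteq> carrier R}" for w
          using that by (auto simp: radical_def)
      qed blast
    qed
  next
    fix x y assume "x \<in> carrier (Zar R)" "y \<in> carrier (Zar R)"
    then obtain S T where "finite S" "finite T" "S \<subseteq> carrier R" "T \<subseteq> carrier R"
      and xy: "x = radical R (Idl S)" "y = radical R (Idl T)"
      by auto
    then show "\<exists>s. least (Zar R) s (Upper (Zar R) {x, y})"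
      "\<exists>s. greatest (Zar R) s (Lower (Zar R) {x, y})"
      unfolding xy by (auto intro!: exI Zar_least Zar_greatest simp del: Zar_simps)
  qed
qed

lemma Zar_join:
  assumes "finite S" "finite T" "S \<subseteq> carrier R" "T \<subseteq> carrier R"
  shows "radical R (Idl S) \<squnion>\<^bsub>Zar R\<^esub> radical R (Idl T) = radical R (Idl (S \<union> T))"
proof -
  interpret bounded_lattice "Zar R" by (rule Zar_bounded_lattice)
  show ?thesis
    unfolding join_def sup_def
    by (rule some_equality)
      (rule Zar_least[OF assms], erule least_unique[OF _ Zar_least[OF assms]])
qed

lemma Zar_meet:
  assumes "finite S" "finite T" "S \<subseteq> carrier R" "T \<subseteq> carrier R"
  shows "radical R (Idl S) \<sqinter>\<^bsub>Zar R\<^esub> radical R (Idl T) =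
    radical R (Idl {s \<otimes> t | s t. s \<in> S \<and> t \<in> T})"
proof -
  interpret bounded_lattice "Zar R" by (rule Zar_bounded_lattice)
  show ?thesis
    unfolding meet_def inf_def
    by (rule some_equality)
      (rule Zar_greatest[OF assms], erule greatest_unique[OF _ Zar_greatest[OF assms]])
qed

lemma Zar_distrib:
  assumes "x \<in> carrier (Zar R)" "y \<in> carrier (Zar R)" "z \<in> carrier (Zar R)"
  shows "x \<sqinter>\<^bsub>Zar R\<^esub> (y \<squnion>\<^bsub>Zar R\<^esub> z) =
    (x \<sqinter>\<^bsub>Zar R\<^esub> y) \<squnion>\<^bsub>Zar R\<^esub> (x \<sqinter>\<^bsub>Zar R\<^esub> z)"
proof -
  from assms obtain S T W where
    fin: "finite S" "finite T" "finite W" and sub: "S \<subseteq> carrier R" "T \<subseteq> carrier R" "W \<subseteq> carrier R"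
    and xyz: "x = radical R (Idl S)" "y = radical R (Idl T)" "z = radical R (Idl W)"
    by auto
  let ?m = "\<lambda>A. {s \<otimes> t | s t. s \<in> S \<and> t \<in> A}"
  have fin_m: "finite (?m A)" if "finite A" for A
    using fin(1) that by (simp add: finite_image_set2)
  have sub_m: "?m A \<subseteq> carrier R" if "A \<subseteq> carrier R" for A
    using sub(1) that by auto
  have "?m (T \<union> W) = ?m T \<union> ?m W" by blast
  then show ?thesis
    unfolding xyz
    by (simp only: Zar_join[OF fin(2,3) sub(2,3)] Zar_meet[OF fin(1,2) sub(1,2)]
        Zar_meet[OF fin(1,3) sub(1,3)] Zar_meet[OF fin(1) finite_UnI[OF fin(2,3)] sub(1) Un_least[OF sub(2,3)]]
        Zar_join[OF fin_m[OF fin(2)] fin_m[OF fin(3)] sub_m[OF sub(2)] sub_m[OF sub(3)]])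
qed

end

end

theory Submission
  imports Defs
begin

text \<open>Everything is read off from prime ideals. An inequality in \<open>Zar R\<close> holds iff it holds at every
  prime \<open>P\<close>, where \<open>x\<close> counts as false if \<open>x \<subseteq> P\<close>. By Krull's lemma, applied from the bottom of the
  chain upwards, a chain of \<open>R\<close> that does not collapse is witnessed by primes \<open>p\<^sub>0 \<subseteq> \<dots> \<subseteq> p\<^sub>l\<close> with
  \<open>J\<^sub>i \<subseteq> p\<^sub>i\<close> and \<open>U\<^sub>i \<inter> p\<^sub>i = \<emptyset>\<close>. Such primes define a nontrivial saturated chain in \<open>Zar R\<close>
  and contradict the entailment system. Conversely, given a collapse, the partial expressions
  \<open>e\<^sub>i = u\<^sub>i e\<^sub>i\<^sub>+\<^sub>1 + j\<^sub>i\<close> with \<open>e\<^sub>0 = 0\<close> yield the solution \<open>x\<^sub>i = zar_of R e\<^sub>i\<close> of the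
  entailment system, and descending in \<open>i\<close> they force every saturated chain to be trivial.\<close>

text \<open>Kept folded, membership in \<open>carrier (Zar R)\<close> is settled by closure lemmas
  instead of being rewritten to an existential over finite generating sets.\<close>

declare Zar_simps(1) [simp del]

context cring
begin

section \<open>Prime ideals and submonoids\<close>

text \<open>Krull's lemma. Zorn gives an ideal \<open>M\<close> maximal among those containing
  \<open>K\<close> and missing \<open>S\<close>. If \<open>a\<close> and \<open>b\<close> were both
  outside \<open>M\<close>, then \<open>M + (a)\<close> and \<open>M + (b)\<close> would meet
  \<open>S\<close>, and with \<open>a \<otimes> b\<close> in \<open>M\<close> the product of the two
  common elements would lie in both \<open>M\<close> and \<open>S\<close>.\<close>

lemma primeideal_avoiding_submonoid:
  assumes K: "ideal K R" and S: "submonoid S R" and disj: "K \<inter> S = {}"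
  obtains P where "primeideal P R" "K \<subseteq> P" "P \<inter> S = {}"
proof -
  interpret S: submonoid S R by fact
  define A where "A = {I. ideal I R \<and> K \<subseteq> I \<and> I \<inter> S = {}}"
  have "\<exists>M\<in>A. \<forall>Y\<in>A. M \<subseteq> Y \<longrightarrow> Y = M"
  proof (rule subset_Zorn_nonempty)
    show "A \<noteq> {}" using K disj by (auto simp: A_def)
    fix C assume C: "C \<noteq> {}" "subset.chain A C"
    then have "subset.chain {I. ideal I R} C"
      unfolding pred_on.chain_def A_def by blast
    from chain_Union_is_ideal[OF this] C show "\<Union>C \<in> A"
      unfolding pred_on.chain_def A_def by auto
  qed
  then obtain M where MA: "M \<in> A" and maxA: "\<And>Y. Y \<in> A \<Longrightarrow> M \<subseteq> Y \<Longrightarrow> Y = M"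
    by blast
  from MA have M: "ideal M R" "K \<subseteq> M" "M \<inter> S = {}" by (simp_all add: A_def)
  have max: "Y = M" if "ideal Y R" "Y \<inter> S = {}" "M \<subseteq> Y" for Y
    using that M(2) by (intro maxA) (auto simp: A_def)
  interpret M: ideal M R by fact
  have split: "\<exists>m\<in>M. \<exists>r\<in>carrier R. m \<oplus> r \<otimes> a \<in> S" if a: "a \<in> carrier R" "a \<notin> M" for a
  proof -
    let ?X = "M <+>\<^bsub>R\<^esub> PIdl a"
    have X: "ideal ?X R"
      using M(1) cgenideal_ideal[OF a(1)] by (rule add_ideals)
    have "M \<union> PIdl a \<subseteq> ?X"
      using genideal_self[of "M \<union> PIdl a"] M.a_subset ideal.Icarr[OF cgenideal_ideal[OF a(1)]]
      unfolding union_genideal[OF M(1) cgenideal_ideal[OF a(1)]] by blast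
    then have MX: "M \<subseteq> ?X" and "a \<in> ?X"
      using cgenideal_self[OF a(1)] by blast+
    with a have "?X \<noteq> M" by blast
    with max[OF X] MX have "?X \<inter> S \<noteq> {}" by blast
    then show ?thesis by (auto simp: set_add_def' cgenideal_def)
  qed
  have "primeideal M R"
  proof (rule primeidealI)
    show "carrier R \<noteq> M" using M(3) S.one_closed by auto
    fix a b assume a: "a \<in> carrier R" and b: "b \<in> carrier R" and ab: "a \<otimes> b \<in> M"
    show "a \<in> M \<or> b \<in> M"
    proof (rule ccontr)
      assume "\<not> ?thesis"
      then have "a \<notin> M" "b \<notin> M" by auto
      from split[OF a this(1)] split[OF b this(2)] obtain m r n t
        where mr: "m \<in> M" "r \<in> carrier R" "m \<oplus> r \<otimes> a \<in> S"
          and nt: "n \<in> M" "t \<in> carrier R" "n \<oplus> t \<otimes> b \<in> S" by blast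
      define s where "s = m \<oplus> r \<otimes> a"
      have s: "s \<in> carrier R" using mr a M.Icarr by (simp add: s_def)
      have "s \<otimes> b = m \<otimes> b \<oplus> r \<otimes> (a \<otimes> b)"
        using mr a b M.Icarr by (simp add: s_def l_distr m_assoc)
      then have sb: "s \<otimes> b \<in> M"
        using mr ab b by (simp add: M.I_l_closed M.I_r_closed)
      \<comment> \<open>This is a product of two elements of \<open>S\<close>; both summands lie in
        \<open>M\<close>, the first by \<open>n\<close> and the second by \<open>sb\<close>.\<close>
      have "s \<otimes> (n \<oplus> t \<otimes> b) = s \<otimes> n \<oplus> t \<otimes> (s \<otimes> b)"
        using nt s b M.Icarr by (simp add: r_distr m_lcomm)
      also have "\<dots> \<in> M"
        using nt s sb by (simp add: M.I_l_closed)
      finally show False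
        using S.m_closed[OF mr(3) nt(3)] M(3) by (auto simp: s_def)
    qed
  qed (use M(1) is_cring in auto)
  with M that show thesis by blast
qed

lemma primeideal_compl_submonoid:
  assumes "primeideal P R"
  shows "submonoid (carrier R - P) R"
proof -
  interpret primeideal P R by fact
  have "\<one> \<notin> P" using one_imp_carrier I_notcarr by auto
  then show ?thesis
    by unfold_locales (auto dest: I_prime)
qed

lemma primeideal_mult_iff:
  assumes "primeideal P R" "a \<in> carrier R" "b \<in> carrier R"
  shows "a \<otimes> b \<in> P \<longleftrightarrow> a \<in> P \<or> b \<in> P"
proof -
  interpret primeideal P R by fact
  show ?thesis using assms(2,3) I_prime I_l_closed I_r_closed by blast
qed

lemma primeideal_zero: "primeideal P R \<Longrightarrow> \<zero> \<in> P"
  by (intro additive_subgroup.zero_closed ideal.axioms(1) primeideal.axioms(1))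

lemma primeideal_one: "primeideal P R \<Longrightarrow> \<one> \<notin> P"
  using submonoid.one_closed[OF primeideal_compl_submonoid] by blast

lemma radical_primeideal:
  assumes "primeideal P R"
  shows "radical R P = P"
proof -
  interpret P: primeideal P R by fact
  have pow: "x \<in> P" if "x \<in> carrier R" "x [^] n \<in> P" for x and n :: nat
    using that(2)
  proof (induction n)
    case (Suc n)
    with that(1) P.I_prime[of "x [^] n" x] show ?case by auto
  qed (use primeideal_one[OF assms] in simp)
  show ?thesis
    using radical_increasing[OF P.a_subset] pow by (auto simp: radical_def)
qed

text \<open>A prime ideal is its own radical, so containment in \<open>P\<close> can be tested on
  generators. This translates statements about elements of \<open>Zar R\<close> into membership in
  primes.\<close>

lemma radical_Idl_subset_primeideal_iff:
  assumes "S \<subseteq> carrier R" "primeideal P R"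
  shows "radical R (Idl S) \<subseteq> P \<longleftrightarrow> S \<subseteq> P"
  using radical_Idl_subset_iff[OF assms(1), of P] radical_primeideal[OF assms(2)]
    primeideal.axioms(1)[OF assms(2)] by simp

lemma gen_submonoid_submonoid:
  assumes "S \<subseteq> carrier R"
  shows "submonoid (gen_submonoid R S) R"
proof -
  \<comment> \<open>The carrier is itself one of the intersected submonoids, which bounds the
    intersection.\<close>
  have "submonoid (carrier R) R" by unfold_locales auto
  then have "gen_submonoid R S \<subseteq> carrier R"
    unfolding gen_submonoid_def using assms by blast
  then show ?thesis
    by (auto simp: gen_submonoid_def submonoid_def)
qed

lemma gen_submonoid_self: "S \<subseteq> gen_submonoid R S"
  unfolding gen_submonoid_def by blast

lemma gen_submonoid_minimal: "submonoid H R \<Longrightarrow> S \<subseteq> H \<Longrightarrow> gen_submonoid R S \<subseteq> H"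
  unfolding gen_submonoid_def by blast

lemma Idl_subset_carrier: "S \<subseteq> carrier R \<Longrightarrow> Idl S \<subseteq> carrier R"
  using ideal.Icarr[OF genideal_ideal] by auto

lemma gen_submonoid_subset_carrier: "S \<subseteq> carrier R \<Longrightarrow> gen_submonoid R S \<subseteq> carrier R"
  using gen_submonoid_submonoid by (rule submonoid.subset)

section \<open>Collapse in a ring and chains of prime ideals\<close>

text \<open>The values of \<open>u 0 (u 1 (\<dots> (u l + j l) \<dots>) + j 1)\<close>, that is, of the chain expression
  without its last summand \<open>j 0\<close>.\<close>

fun chain_monoid :: "nat \<Rightarrow> (nat \<Rightarrow> 'a set) \<Rightarrow> (nat \<Rightarrow> 'a set) \<Rightarrow> 'a set" where
  "chain_monoid 0 J U = gen_submonoid R (U 0)"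
| "chain_monoid (Suc l) J U =
     {v \<otimes> (b \<oplus> a) | v b a. v \<in> gen_submonoid R (U 0) \<and>
        b \<in> chain_monoid l (\<lambda>i. J (Suc i)) (\<lambda>i. U (Suc i)) \<and> a \<in> Idl (J (Suc 0))}"

text \<open>Closure under products is what allows Krull's lemma to be applied to the whole nested
  expression at once. In a product of two inner sums, everything except
  \<open>b \<otimes> b'\<close> is absorbed by the ideal.\<close>

lemma chain_monoid_submonoid:
  assumes "idealistic_chain R l J U"
  shows "submonoid (chain_monoid l J U) R"
  using assms
proof (induction l arbitrary: J U)
  case 0
  then show ?case by (simp add: gen_submonoid_submonoid idealistic_chain_def)
next
  case (Suc l)
  let ?J = "\<lambda>i. J (Suc i)" and ?U = "\<lambda>i. U (Suc i)"
  have "idealistic_chain R l ?J ?U"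
    using Suc.prems by (simp add: idealistic_chain_def)
  then interpret B: submonoid "chain_monoid l ?J ?U" R by (rule Suc.IH)
  interpret V: submonoid "gen_submonoid R (U 0)" R
    using Suc.prems by (intro gen_submonoid_submonoid) (simp add: idealistic_chain_def)
  interpret I: ideal "Idl (J (Suc 0))" R
    using Suc.prems by (intro genideal_ideal) (simp add: idealistic_chain_def)
  have V: "v \<in> carrier R" if "v \<in> gen_submonoid R (U 0)" for v using that V.subset by blast
  have B: "v \<in> carrier R" if "v \<in> chain_monoid l ?J ?U" for v using that B.subset by blast
  show ?case
  proof
    show "chain_monoid (Suc l) J U \<subseteq> carrier R"
      using V B I.Icarr by auto
    have "\<one> = \<one> \<otimes> (\<one> \<oplus> \<zero>)" by simp
    then show "\<one> \<in> chain_monoid (Suc l) J U"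
      using V.one_closed B.one_closed I.zero_closed by (simp only: chain_monoid.simps) blast
    fix x y assume "x \<in> chain_monoid (Suc l) J U" "y \<in> chain_monoid (Suc l) J U"
    then obtain v b a v' b' a' where x: "x = v \<otimes> (b \<oplus> a)" "v \<in> gen_submonoid R (U 0)"
        "b \<in> chain_monoid l ?J ?U" "a \<in> Idl (J (Suc 0))"
      and y: "y = v' \<otimes> (b' \<oplus> a')" "v' \<in> gen_submonoid R (U 0)"
        "b' \<in> chain_monoid l ?J ?U" "a' \<in> Idl (J (Suc 0))" by auto
    note [simp] = V[OF x(2)] V[OF y(2)] B[OF x(3)] B[OF y(3)] I.Icarr[OF x(4)] I.Icarr[OF y(4)]
    \<comment> \<open>The ideal part of
      \<open>(b \<oplus> a) \<otimes> (b' \<oplus> a')\<close>.\<close>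
    let ?a = "b \<otimes> a' \<oplus> a \<otimes> (b' \<oplus> a')"
    have "x \<otimes> y = (v \<otimes> v') \<otimes> ((b \<oplus> a) \<otimes> (b' \<oplus> a'))"
      unfolding x(1) y(1) by (simp add: m_ac)
    also have "(b \<oplus> a) \<otimes> (b' \<oplus> a') = b \<otimes> b' \<oplus> ?a"
      by (simp add: l_distr r_distr a_ac)
    finally have "x \<otimes> y = (v \<otimes> v') \<otimes> (b \<otimes> b' \<oplus> ?a)" .
    moreover have "?a \<in> Idl (J (Suc 0))"
      using x(4) y(4) by (simp add: I.I_l_closed I.I_r_closed)
    ultimately show "x \<otimes> y \<in> chain_monoid (Suc l) J U"
      using V.m_closed[OF x(2) y(2)] B.m_closed[OF x(3) y(3)]
      by (simp only: chain_monoid.simps) blast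
  qed
qed

text \<open>The element \<open>a\<close> supplies the last summand \<open>j 0\<close> that
  \<open>chain_monoid\<close> leaves out. It is arbitrary because the inner factor
  \<open>b' \<oplus> a'\<close> must have the same shape for the induction.\<close>

lemma chain_monoid_imp_chain_expr:
  assumes "b \<in> chain_monoid l J U" "a \<in> Idl (J 0)"
  shows "\<exists>j u. (\<forall>i\<le>l. j i \<in> Idl (J i) \<and> u i \<in> gen_submonoid R (U i)) \<and>
           chain_expr R l j u = b \<oplus> a"
  using assms
proof (induction l arbitrary: J U b a)
  case 0
  then show ?case by (intro exI[of _ "\<lambda>_. a"] exI[of _ "\<lambda>_. b"]) simp
next
  case (Suc l)
  then obtain v b' a' where b: "b = v \<otimes> (b' \<oplus> a')" and v: "v \<in> gen_submonoid R (U 0)"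
    and b': "b' \<in> chain_monoid l (\<lambda>i. J (Suc i)) (\<lambda>i. U (Suc i))" and a': "a' \<in> Idl (J (Suc 0))"
    by auto
  from Suc.IH[OF b' a'] obtain j u where
    ju: "\<forall>i\<le>l. j i \<in> Idl (J (Suc i)) \<and> u i \<in> gen_submonoid R (U (Suc i))"
      "chain_expr R l j u = b' \<oplus> a'"
    by auto
  \<comment> \<open>\<open>case_nat\<close> puts the outermost pair in front of the families
    obtained for the shifted chain.\<close>
  have "case_nat a j i \<in> Idl (J i) \<and> case_nat v u i \<in> gen_submonoid R (U i)" if "i \<le> Suc l" for i
    using that ju(1) v Suc.prems(2) by (cases i) auto
  moreover have "chain_expr R (Suc l) (case_nat a j) (case_nat v u) = b \<oplus> a"
    by (simp add: ju(2) b)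
  ultimately show ?case by blast
qed

text \<open>Induction that splits off the bottom pair. \<open>K\<close> replaces the ideal generated
  by \<open>J 0\<close> so that it can carry the prime already chosen: after \<open>P\<close> is
  found above \<open>K\<close>, the induction hypothesis is applied to the sum of \<open>P\<close>
  and the ideal generated by \<open>J 1\<close>, which makes the next prime contain
  \<open>P\<close>.\<close>

lemma prime_chain_above:
  assumes "idealistic_chain R l J U" "ideal K R" "J 0 \<subseteq> K" "K \<inter> chain_monoid l J U = {}"
  shows "\<exists>p. K \<subseteq> p 0 \<and> (\<forall>i\<le>l. primeideal (p i) R \<and> J i \<subseteq> p i \<and> U i \<inter> p i = {}) \<and>
           (\<forall>i<l. p i \<subseteq> p (Suc i))"
  using assms
proof (induction l arbitrary: J U K)
  case 0
  have "submonoid (gen_submonoid R (U 0)) R"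
    using chain_monoid_submonoid[OF 0(1)] by simp
  from primeideal_avoiding_submonoid[OF 0(2) this] 0(4)
  obtain P where "primeideal P R" "K \<subseteq> P" "P \<inter> gen_submonoid R (U 0) = {}"
    by auto
  then show ?case
    using 0(3) gen_submonoid_self[of "U 0"] by (intro exI[of _ "\<lambda>_. P"]) auto
next
  case (Suc l)
  let ?J = "\<lambda>i. J (Suc i)" and ?U = "\<lambda>i. U (Suc i)"
  have chain: "idealistic_chain R l ?J ?U" and U0: "U 0 \<subseteq> carrier R" and J1: "J (Suc 0) \<subseteq> carrier R"
    using Suc.prems(1) by (simp_all add: idealistic_chain_def)
  interpret B: submonoid "chain_monoid l ?J ?U" R using chain by (rule chain_monoid_submonoid)
  interpret V: submonoid "gen_submonoid R (U 0)" R using U0 by (rule gen_submonoid_submonoid)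
  interpret I: ideal "Idl (J (Suc 0))" R using J1 by (rule genideal_ideal)
  obtain P where P: "primeideal P R" "K \<subseteq> P" "P \<inter> chain_monoid (Suc l) J U = {}"
    using primeideal_avoiding_submonoid[OF Suc.prems(2) chain_monoid_submonoid[OF Suc.prems(1)] Suc.prems(4)]
    by metis
  interpret P: primeideal P R by fact
  have UP: "U 0 \<inter> P = {}"
  proof -
    have "x \<in> chain_monoid (Suc l) J U" if "x \<in> U 0" for x
    proof -
      have "x = x \<otimes> (\<one> \<oplus> \<zero>)" using that U0 by auto
      moreover have "x \<in> gen_submonoid R (U 0)" using that gen_submonoid_self by blast
      ultimately show ?thesis
        using B.one_closed I.zero_closed by (simp only: chain_monoid.simps) blast
    qed
    with P(3) show ?thesis by blast
  qed
  let ?K = "Idl (J (Suc 0)) <+>\<^bsub>R\<^esub> P"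
  have K: "ideal ?K R" using I.is_ideal P.is_ideal by (rule add_ideals)
  have "Idl (J (Suc 0)) \<union> P \<subseteq> ?K"
    using genideal_self[of "Idl (J (Suc 0)) \<union> P"] I.a_subset P.a_subset
    unfolding union_genideal[OF I.is_ideal P.is_ideal] by blast
  then have PK: "P \<subseteq> ?K" and JK: "J (Suc 0) \<subseteq> ?K"
    using genideal_self[OF J1] by blast+
  have disj: "?K \<inter> chain_monoid l ?J ?U = {}"
  proof (rule ccontr)
    assume "\<not> ?thesis"
    then obtain a q where a: "a \<in> Idl (J (Suc 0))" and q: "q \<in> P" and b: "a \<oplus> q \<in> chain_monoid l ?J ?U"
      by (auto simp: set_add_def')
    \<comment> \<open>If \<open>a \<oplus> q\<close> were in the inner monoid, cancelling
      \<open>a\<close> by the admissible summand \<open>\<ominus> a\<close> would exhibit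
      \<open>q\<close> as an element of the full chain monoid, which \<open>P\<close>
      avoids.\<close>
    have "q = \<one> \<otimes> ((a \<oplus> q) \<oplus> \<ominus> a)"
      using I.Icarr[OF a] P.Icarr[OF q] by (simp add: a_comm[of "a \<oplus> q"] r_neg1)
    moreover have "\<ominus> a \<in> Idl (J (Suc 0))" using a by simp
    ultimately have "q \<in> chain_monoid (Suc l) J U"
      using b V.one_closed by (simp only: chain_monoid.simps) blast
    with q P(3) show False by blast
  qed
  from Suc.IH[OF chain K JK disj] obtain p where p: "?K \<subseteq> p 0"
    "\<forall>i\<le>l. primeideal (p i) R \<and> J (Suc i) \<subseteq> p i \<and> U (Suc i) \<inter> p i = {}" "\<forall>i<l. p i \<subseteq> p (Suc i)"
    by blast
  have "primeideal (case_nat P p i) R \<and> J i \<subseteq> case_nat P p i \<and> U i \<inter> case_nat P p i = {}"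
    if "i \<le> Suc l" for i
    using that p(2) P(1,2) UP Suc.prems(3) by (cases i) auto
  moreover have "case_nat P p i \<subseteq> case_nat P p (Suc i)" if "i < Suc l" for i
    using that p(1,3) PK by (cases i) auto
  ultimately show ?case
    using P(2) by (intro exI[of _ "case_nat P p"] conjI allI impI) simp_all
qed

text \<open>An element \<open>b\<close> common to the ideal of \<open>J 0\<close> and the chain
  monoid would give a collapse with last summand \<open>\<ominus> b\<close>. So the two are disjoint
  and the construction of primes can start from that ideal.\<close>

lemma not_ring_collapses_imp_prime_chain:
  assumes chain: "idealistic_chain R l J U" and ncol: "\<not> ring_collapses R l J U"
  obtains p where "\<forall>i\<le>l. primeideal (p i) R \<and> J i \<subseteq> p i \<and> U i \<inter> p i = {}"
    "\<forall>i<l. p i \<subseteq> p (Suc i)"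
proof -
  have J0: "J 0 \<subseteq> carrier R" using chain by (simp add: idealistic_chain_def)
  interpret I: ideal "Idl (J 0)" R using J0 by (rule genideal_ideal)
  have "Idl (J 0) \<inter> chain_monoid l J U = {}"
  proof (rule ccontr)
    assume "\<not> ?thesis"
    then obtain b where b: "b \<in> Idl (J 0)" "b \<in> chain_monoid l J U" by blast
    then have "\<ominus> b \<in> Idl (J 0)" by simp
    from chain_monoid_imp_chain_expr[OF b(2) this] ncol show False
      using I.Icarr[OF b(1)] by (auto simp: ring_collapses_def r_neg)
  qed
  from prime_chain_above[OF chain I.is_ideal genideal_self[OF J0] this] that show thesis by blast
qed

section \<open>The Zariski lattice and prime ideals\<close>

lemma radical_Idl_in_Zar: "finite S \<Longrightarrow> S \<subseteq> carrier R \<Longrightarrow> radical R (Idl S) \<in> carrier (Zar R)"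
  unfolding Zar_simps by blast

lemma zar_of_closed: "a \<in> carrier R \<Longrightarrow> zar_of R a \<in> carrier (Zar R)"
  by (simp add: zar_of_def radical_Idl_in_Zar)

lemma Zar_cases:
  assumes "x \<in> carrier (Zar R)"
  obtains S where "finite S" "S \<subseteq> carrier R" "x = radical R (Idl S)"
  using assms unfolding Zar_simps by blast

lemma Zar_ideal:
  assumes "x \<in> carrier (Zar R)"
  shows "ideal x R"
  using assms by (auto elim!: Zar_cases intro: radical_ideal genideal_ideal)

lemma zar_of_subset_primeideal_iff:
  "a \<in> carrier R \<Longrightarrow> primeideal P R \<Longrightarrow> zar_of R a \<subseteq> P \<longleftrightarrow> a \<in> P"
  by (simp add: zar_of_def radical_Idl_subset_primeideal_iff)

text \<open>A radical ideal is the intersection of the primes above it: if \<open>a\<close> is not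
  in \<open>y\<close>, no power of \<open>a\<close> is, and Krull's lemma for the powers of
  \<open>a\<close> gives a prime above \<open>y\<close> without \<open>a\<close>.\<close>

lemma Zar_subset_iff_primeideals:
  assumes x: "x \<in> carrier (Zar R)" and y: "y \<in> carrier (Zar R)"
  shows "x \<subseteq> y \<longleftrightarrow> (\<forall>P. primeideal P R \<longrightarrow> y \<subseteq> P \<longrightarrow> x \<subseteq> P)"
proof
  assume prm: "\<forall>P. primeideal P R \<longrightarrow> y \<subseteq> P \<longrightarrow> x \<subseteq> P"
  show "x \<subseteq> y"
  proof
    fix a assume a: "a \<in> x"
    then have aR: "a \<in> carrier R" using ideal.Icarr[OF Zar_ideal[OF x]] by simp
    obtain S where S: "S \<subseteq> carrier R" and y_eq: "y = radical R (Idl S)"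
      using y by (rule Zar_cases)
    show "a \<in> y"
    proof (rule ccontr)
      assume "a \<notin> y"
      define A where "A = range (\<lambda>n::nat. a [^] n)"
      have disj: "y \<inter> A = {}"
        using \<open>a \<notin> y\<close> aR by (auto simp: A_def y_eq radical_def nat_pow_pow)
      have "submonoid A R"
      proof
        show "\<one> \<in> A" unfolding A_def using nat_pow_0[of a] by (rule range_eqI[OF sym])
      qed (use aR in \<open>auto simp: A_def nat_pow_mult\<close>)
      from Zar_ideal[OF y] this disj obtain P where P: "primeideal P R" "y \<subseteq> P" "P \<inter> A = {}"
        by (rule primeideal_avoiding_submonoid)
      have "a = a [^] (1::nat)" using aR by simp
      then have "a \<in> A" unfolding A_def by (rule range_eqI)
      then have "a \<notin> P" using P(3) by blast
      then show False using prm P(1,2) a by blast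
    qed
  qed
qed blast

text \<open>Reduces lattice identities in \<open>Zar R\<close> to propositional checks at each
  prime.\<close>

lemma Zar_eqI_primeideals:
  assumes "x \<in> carrier (Zar R)" "y \<in> carrier (Zar R)"
    and "\<And>P. primeideal P R \<Longrightarrow> x \<subseteq> P \<longleftrightarrow> y \<subseteq> P"
  shows "x = y"
  using assms Zar_subset_iff_primeideals[of x y] Zar_subset_iff_primeideals[of y x] by blast

text \<open>Elements of \<open>x\<close> and \<open>y\<close> outside \<open>P\<close> have their
  product in \<open>x \<inter> y\<close> but not in \<open>P\<close>.\<close>

lemma Int_subset_primeideal_iff:
  assumes x: "ideal x R" and y: "ideal y R" and P: "primeideal P R"
  shows "x \<inter> y \<subseteq> P \<longleftrightarrow> x \<subseteq> P \<or> y \<subseteq> P"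
proof
  assume xy: "x \<inter> y \<subseteq> P"
  show "x \<subseteq> P \<or> y \<subseteq> P"
  proof (rule ccontr)
    assume "\<not> ?thesis"
    then obtain a b where ab: "a \<in> x" "a \<notin> P" "b \<in> y" "b \<notin> P" by blast
    then have "a \<in> carrier R" "b \<in> carrier R"
      using ideal.Icarr[OF x] ideal.Icarr[OF y] by auto
    moreover from this ab have "a \<otimes> b \<in> x \<inter> y"
      using ideal.I_r_closed[OF x] ideal.I_l_closed[OF y] by simp
    ultimately show False
      using ab xy primeideal.I_prime[OF P] by blast
  qed
qed blast

section \<open>Finite joins and meets in the Zariski lattice, tested at primes\<close>

lemma
  assumes B: "finite B" "B \<subseteq> carrier (Zar R)"
  shows Zar_Sup_closed: "\<Squnion>\<^bsub>Zar R\<^esub> B \<in> carrier (Zar R)"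
    and Zar_Sup_subset_primeideal_iff:
      "\<And>P. primeideal P R \<Longrightarrow> \<Squnion>\<^bsub>Zar R\<^esub> B \<subseteq> P \<longleftrightarrow> (\<forall>b\<in>B. b \<subseteq> P)"
proof -
  interpret bounded_lattice "Zar R" by (rule Zar_bounded_lattice)
  have "\<forall>b\<in>B. \<exists>S. finite S \<and> S \<subseteq> carrier R \<and> b = radical R (Idl S)"
    using B(2) by (blast elim: Zar_cases)
  then obtain G where G: "\<And>b. b \<in> B \<Longrightarrow> finite (G b)" "\<And>b. b \<in> B \<Longrightarrow> G b \<subseteq> carrier R"
    "\<And>b. b \<in> B \<Longrightarrow> b = radical R (Idl (G b))" by metis
  \<comment> \<open>The candidate for the join: the union of finite generating sets generates the
    sum of the ideals.\<close>
  define s where "s = radical R (Idl (\<Union>b\<in>B. G b))"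
  have GR: "(\<Union>b\<in>B. G b) \<subseteq> carrier R" using G(2) by blast
  have s: "s \<in> carrier (Zar R)"
    unfolding s_def using B(1) G(1) GR by (simp add: radical_Idl_in_Zar)
  have prm: "s \<subseteq> P \<longleftrightarrow> (\<forall>b\<in>B. b \<subseteq> P)" if P: "primeideal P R" for P
  proof -
    have "b \<subseteq> P \<longleftrightarrow> G b \<subseteq> P" if "b \<in> B" for b
      using G(3)[OF that] radical_Idl_subset_primeideal_iff[OF G(2)[OF that] P] by simp
    then show ?thesis
      unfolding s_def radical_Idl_subset_primeideal_iff[OF GR P] by blast
  qed
  have le: "b \<subseteq> s" if b: "b \<in> B" for b
  proof -
    have "b \<in> carrier (Zar R)" using b B(2) by blast
    then show ?thesis using b s prm by (simp add: Zar_subset_iff_primeideals)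
  qed
  \<comment> \<open>A prime containing \<open>w\<close> contains every member of \<open>B\<close>,
    hence \<open>s\<close>.\<close>
  have "s \<subseteq> w" if w: "w \<in> carrier (Zar R)" "\<And>b. b \<in> B \<Longrightarrow> b \<subseteq> w" for w
    unfolding Zar_subset_iff_primeideals[OF s w(1)] using prm w(2) by blast
  then have least: "least (Zar R) s (Upper (Zar R) B)"
    using s le B(2) by (simp add: least_def Upper_def subset_iff[of B])
  \<comment> \<open>The supremum is a \<open>SOME\<close> choice, identified by uniqueness of least
    elements.\<close>
  have "\<Squnion>\<^bsub>Zar R\<^esub> B = s"
    unfolding sup_def by (rule some_equality) (rule least, erule least_unique[OF _ least])
  then show "\<Squnion>\<^bsub>Zar R\<^esub> B \<in> carrier (Zar R)"
    "\<And>P. primeideal P R \<Longrightarrow> \<Squnion>\<^bsub>Zar R\<^esub> B \<subseteq> P \<longleftrightarrow> (\<forall>b\<in>B. b \<subseteq> P)"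
    using s prm by simp_all
qed

text \<open>Intersecting with \<open>carrier R\<close> takes care of the empty family.\<close>

lemma Zar_Inter:
  assumes "finite A" "A \<subseteq> carrier (Zar R)"
  shows "carrier R \<inter> \<Inter>A \<in> carrier (Zar R) \<and>
    (\<forall>P. primeideal P R \<longrightarrow> (carrier R \<inter> \<Inter>A \<subseteq> P \<longleftrightarrow> (\<exists>a\<in>A. a \<subseteq> P)))"
  using assms
proof (induction A rule: finite_induct)
  case empty
  have "radical R (Idl {\<one>}) = carrier R"
    by (auto simp: radical_def genideal_one)
  then have "carrier R \<in> carrier (Zar R)"
    using radical_Idl_in_Zar[of "{\<one>}"] by simp
  moreover have "\<not> carrier R \<subseteq> P" if "primeideal P R" for P
    using primeideal.I_notcarr[OF that] ideal.Icarr[OF primeideal.axioms(1)[OF that]] by blast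
  ultimately show ?case by simp
next
  case (insert a A)
  let ?I = "carrier R \<inter> \<Inter>A"
  have a: "a \<in> carrier (Zar R)" and IH: "?I \<in> carrier (Zar R)"
    "\<And>P. primeideal P R \<Longrightarrow> ?I \<subseteq> P \<longleftrightarrow> (\<exists>a\<in>A. a \<subseteq> P)"
    using insert by auto
  have eq: "carrier R \<inter> \<Inter>(insert a A) = a \<inter> ?I" by blast
  obtain S T where S: "finite S" "S \<subseteq> carrier R" "a = radical R (Idl S)"
    and T: "finite T" "T \<subseteq> carrier R" "?I = radical R (Idl T)"
    using a IH(1) by (metis Zar_cases)
  have "a \<inter> ?I \<in> carrier (Zar R)"
    unfolding S(3) T(3) radical_Idl_Int[OF S(2) T(2)]
    using S(1,2) T(1,2) by (intro radical_Idl_in_Zar finite_image_set2) auto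
  moreover have "a \<inter> ?I \<subseteq> P \<longleftrightarrow> (\<exists>b\<in>insert a A. b \<subseteq> P)" if P: "primeideal P R" for P
    using Int_subset_primeideal_iff[OF Zar_ideal[OF a] Zar_ideal[OF IH(1)] P] IH(2)[OF P] by simp
  ultimately show ?case unfolding eq by blast
qed

text \<open>The order is inclusion, so the intersection is the meet as soon as it belongs to the
  lattice, which \<open>Zar_Inter\<close> provides.\<close>

lemma Zar_Inf:
  assumes A: "finite A" "A \<subseteq> carrier (Zar R)"
  shows "\<Sqinter>\<^bsub>Zar R\<^esub> A = carrier R \<inter> \<Inter>A"
proof -
  interpret bounded_lattice "Zar R" by (rule Zar_bounded_lattice)
  have greatest: "greatest (Zar R) (carrier R \<inter> \<Inter>A) (Lower (Zar R) A)"
    unfolding greatest_def Zar_simps(3)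
  proof (intro conjI ballI)
    show "carrier R \<inter> \<Inter>A \<in> Lower (Zar R) A"
      using conjunct1[OF Zar_Inter[OF A]] by (auto simp: Lower_def)
    fix w assume "w \<in> Lower (Zar R) A"
    then have w: "w \<in> carrier (Zar R)" "\<And>a. a \<in> A \<Longrightarrow> w \<subseteq> a"
      using A(2) by (simp_all add: Lower_def subset_iff[of A])
    have "w \<subseteq> carrier R" using ideal.Icarr[OF Zar_ideal[OF w(1)]] by (rule subsetI)
    with w(2) show "w \<subseteq> carrier R \<inter> \<Inter>A" by blast
  qed simp
  show ?thesis
    unfolding inf_def by (rule some_equality) (rule greatest, erule greatest_unique[OF _ greatest])
qed

lemma
  assumes A: "finite A" "A \<subseteq> carrier (Zar R)"
  shows Zar_Inf_closed: "\<Sqinter>\<^bsub>Zar R\<^esub> A \<in> carrier (Zar R)"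
    and Zar_Inf_subset_primeideal_iff:
      "\<And>P. primeideal P R \<Longrightarrow> \<Sqinter>\<^bsub>Zar R\<^esub> A \<subseteq> P \<longleftrightarrow> (\<exists>a\<in>A. a \<subseteq> P)"
  using Zar_Inter[OF A] by (simp_all add: Zar_Inf[OF A])

text \<open>With "true at \<open>P\<close>" meaning "not contained in \<open>P\<close>", the
  right-hand side is the contrapositive of: if all of \<open>A\<close> is true at \<open>P\<close>,
  then some member of \<open>B\<close> is.\<close>

lemma entails_Zar_iff_primeideals:
  assumes "finite A" "A \<subseteq> carrier (Zar R)" "finite B" "B \<subseteq> carrier (Zar R)"
  shows "entails (Zar R) A B \<longleftrightarrow>
    (\<forall>P. primeideal P R \<longrightarrow> (\<forall>b\<in>B. b \<subseteq> P) \<longrightarrow> (\<exists>a\<in>A. a \<subseteq> P))"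
  unfolding entails_def Zar_simps
  using Zar_subset_iff_primeideals[OF Zar_Inf_closed[OF assms(1,2)] Zar_Sup_closed[OF assms(3,4)]]
  by (simp add: Zar_Inf_subset_primeideal_iff[OF assms(1,2)] Zar_Sup_subset_primeideal_iff[OF assms(3,4)])

lemma
  assumes "x \<in> carrier (Zar R)" "y \<in> carrier (Zar R)"
  shows Zar_join_closed: "x \<squnion>\<^bsub>Zar R\<^esub> y \<in> carrier (Zar R)"
    and Zar_meet_closed: "x \<sqinter>\<^bsub>Zar R\<^esub> y \<in> carrier (Zar R)"
    and Zar_join_subset_primeideal_iff:
      "\<And>P. primeideal P R \<Longrightarrow> x \<squnion>\<^bsub>Zar R\<^esub> y \<subseteq> P \<longleftrightarrow> x \<subseteq> P \<and> y \<subseteq> P"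
    and Zar_meet_subset_primeideal_iff:
      "\<And>P. primeideal P R \<Longrightarrow> x \<sqinter>\<^bsub>Zar R\<^esub> y \<subseteq> P \<longleftrightarrow> x \<subseteq> P \<or> y \<subseteq> P"
  using assms Zar_Sup_closed[of "{x, y}"] Zar_Inf_closed[of "{x, y}"]
    Zar_Sup_subset_primeideal_iff[of "{x, y}"] Zar_Inf_subset_primeideal_iff[of "{x, y}"]
  by (simp_all add: join_def meet_def)

lemma
  shows Zar_bottom_closed: "\<bottom>\<^bsub>Zar R\<^esub> \<in> carrier (Zar R)"
    and Zar_top_closed: "\<top>\<^bsub>Zar R\<^esub> \<in> carrier (Zar R)"
    and Zar_bottom_subset_primeideal: "\<And>P. primeideal P R \<Longrightarrow> \<bottom>\<^bsub>Zar R\<^esub> \<subseteq> P"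
    and Zar_top_not_subset_primeideal: "\<And>P. primeideal P R \<Longrightarrow> \<not> \<top>\<^bsub>Zar R\<^esub> \<subseteq> P"
proof -
  interpret bounded_lattice "Zar R" by (rule Zar_bounded_lattice)
  show "\<bottom>\<^bsub>Zar R\<^esub> \<in> carrier (Zar R)" "\<top>\<^bsub>Zar R\<^esub> \<in> carrier (Zar R)" by simp_all
  \<comment> \<open>Comparison with the classes of zero and one settles bottom and top at every
    prime.\<close>
  have "\<bottom>\<^bsub>Zar R\<^esub> \<subseteq> zar_of R \<zero>" "zar_of R \<one> \<subseteq> \<top>\<^bsub>Zar R\<^esub>"
    using bottom_lower[OF zar_of_closed] top_higher[OF zar_of_closed] by simp_all
  moreover have "zar_of R \<zero> \<subseteq> P" "\<not> zar_of R \<one> \<subseteq> P" if P: "primeideal P R" for P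
    using P by (simp_all add: zar_of_subset_primeideal_iff primeideal_zero primeideal_one)
  ultimately show "\<And>P. primeideal P R \<Longrightarrow> \<bottom>\<^bsub>Zar R\<^esub> \<subseteq> P"
    "\<And>P. primeideal P R \<Longrightarrow> \<not> \<top>\<^bsub>Zar R\<^esub> \<subseteq> P" by blast+
qed

lemmas Zar_closed = zar_of_closed Zar_join_closed Zar_meet_closed Zar_bottom_closed Zar_top_closed

lemmas Zar_subset_primeideal_iff = zar_of_subset_primeideal_iff
  Zar_join_subset_primeideal_iff Zar_meet_subset_primeideal_iff
  Zar_bottom_subset_primeideal Zar_top_not_subset_primeideal

lemma zar_of_mult:
  assumes "a \<in> carrier R" "b \<in> carrier R"
  shows "zar_of R (a \<otimes> b) = zar_of R a \<sqinter>\<^bsub>Zar R\<^esub> zar_of R b"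
  using assms
  by (intro Zar_eqI_primeideals)
    (simp_all add: Zar_closed Zar_subset_primeideal_iff primeideal_mult_iff)

lemma zar_of_zero: "zar_of R \<zero> = \<bottom>\<^bsub>Zar R\<^esub>"
  by (intro Zar_eqI_primeideals)
    (simp_all add: Zar_closed Zar_subset_primeideal_iff primeideal_zero)

lemma zar_of_one: "zar_of R \<one> = \<top>\<^bsub>Zar R\<^esub>"
  by (intro Zar_eqI_primeideals)
    (simp_all add: Zar_closed Zar_subset_primeideal_iff primeideal_one)

section \<open>Collapse in the Zariski lattice\<close>

text \<open>A prime acts as a two-valued valuation of \<open>Zar R\<close>. Its false elements form
  an ideal, and the next two lemmas show that its true elements form a filter conjugate to
  it.\<close>

lemma lat_ideal_Zar_primeideal:
  assumes "primeideal P R"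
  shows "lat_ideal (Zar R) {x \<in> carrier (Zar R). x \<subseteq> P}"
  using assms by (simp add: lat_ideal_def Zar_closed Zar_subset_primeideal_iff)

lemma lat_filter_Zar_primeideal:
  assumes "primeideal P R"
  shows "lat_filter (Zar R) {x \<in> carrier (Zar R). \<not> x \<subseteq> P}"
  using assms by (simp add: lat_filter_def Zar_closed Zar_subset_primeideal_iff)

lemma conjugate_Zar_primeideal:
  assumes "primeideal P R"
  shows "conjugate (Zar R) {x \<in> carrier (Zar R). x \<subseteq> P} {x \<in> carrier (Zar R). \<not> x \<subseteq> P}"
  using assms by (simp add: conjugate_def Zar_closed Zar_subset_primeideal_iff)

text \<open>The valuations of an increasing chain of primes give a saturated chain: as the primes
  grow, the ideals grow and the filters shrink. It is not trivial, since bottom is never in a filter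
  of this kind.\<close>

lemma lat_collapses_imp_ring_collapses:
  assumes chain: "idealistic_chain R l J U"
    and col: "lat_collapses (Zar R) l (\<lambda>i. zar_of R ` J i) (\<lambda>i. zar_of R ` U i)"
  shows "ring_collapses R l J U"
proof (rule ccontr)
  assume "\<not> ?thesis"
  with chain obtain p where "\<forall>i\<le>l. primeideal (p i) R \<and> J i \<subseteq> p i \<and> U i \<inter> p i = {}"
    "\<forall>i<l. p i \<subseteq> p (Suc i)"
    by (rule not_ring_collapses_imp_prime_chain)
  then have p: "\<And>i. i \<le> l \<Longrightarrow> primeideal (p i) R" "\<And>i. i \<le> l \<Longrightarrow> J i \<subseteq> p i"
    "\<And>i. i \<le> l \<Longrightarrow> U i \<inter> p i = {}" "\<And>i. i < l \<Longrightarrow> p i \<subseteq> p (Suc i)"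
    by simp_all
  let ?J = "\<lambda>i. {x \<in> carrier (Zar R). x \<subseteq> p i}" and ?U = "\<lambda>i. {x \<in> carrier (Zar R). \<not> x \<subseteq> p i}"
  have "saturated (Zar R) l ?J ?U"
    unfolding saturated_def
    using p(1,4) lat_ideal_Zar_primeideal lat_filter_Zar_primeideal conjugate_Zar_primeideal by blast
  moreover have "refines l ?J ?U (\<lambda>i. zar_of R ` J i) (\<lambda>i. zar_of R ` U i)"
    unfolding refines_def
  proof (intro allI impI)
    fix i assume i: "i \<le> l"
    then have J: "J i \<subseteq> carrier R" and U: "U i \<subseteq> carrier R"
      using chain by (simp_all add: idealistic_chain_def)
    have "zar_of R a \<in> ?J i" if "a \<in> J i" for a
      using that J p(2)[OF i] zar_of_subset_primeideal_iff[OF _ p(1)[OF i], of a] zar_of_closed[of a] by blast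
    moreover have "zar_of R a \<in> ?U i" if "a \<in> U i" for a
      using that U p(3)[OF i] zar_of_subset_primeideal_iff[OF _ p(1)[OF i], of a] zar_of_closed[of a] by blast
    ultimately show "zar_of R ` J i \<subseteq> ?J i \<and> zar_of R ` U i \<subseteq> ?U i" by blast
  qed
  ultimately have "?U 0 = carrier (Zar R)"
    using col unfolding lat_collapses_def by blast
  then show False
    using Zar_bottom_closed Zar_bottom_subset_primeideal[OF p(1)[of 0]] by blast
qed

section \<open>From a collapse in the ring to a collapse in its Zariski lattice\<close>

lemma lat_ideal_zar_of_ideal:
  assumes I: "lat_ideal (Zar R) I"
  shows "ideal {a \<in> carrier R. zar_of R a \<in> I} R"
proof (rule idealI)
  have sub: "I \<subseteq> carrier (Zar R)" and bot: "\<bottom>\<^bsub>Zar R\<^esub> \<in> I"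
    and join: "\<And>x y. x \<in> I \<Longrightarrow> y \<in> I \<Longrightarrow> x \<squnion>\<^bsub>Zar R\<^esub> y \<in> I"
    and meet: "\<And>x y. x \<in> I \<Longrightarrow> y \<in> carrier (Zar R) \<Longrightarrow> x \<sqinter>\<^bsub>Zar R\<^esub> y \<in> I"
    using I by (auto simp: lat_ideal_def)
  show "ring R" by (rule ring_axioms)
  have mult: "zar_of R (a \<otimes> x) \<in> I" if "a \<in> carrier R" "x \<in> carrier R" "zar_of R a \<in> I" for a x
    using that meet zar_of_closed by (simp add: zar_of_mult)
  show "subgroup {a \<in> carrier R. zar_of R a \<in> I} (add_monoid R)"
  proof (rule add.subgroupI)
    show "{a \<in> carrier R. zar_of R a \<in> I} \<noteq> {}" using bot zar_of_zero by force
    show "\<ominus> a \<in> {a \<in> carrier R. zar_of R a \<in> I}" if "a \<in> {a \<in> carrier R. zar_of R a \<in> I}" for a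
    proof -
      have "\<ominus> a = a \<otimes> (\<ominus> \<one>)" using that by (simp add: r_minus)
      then show ?thesis using that mult[of a "\<ominus> \<one>"] by simp
    qed
    fix a b assume "a \<in> {a \<in> carrier R. zar_of R a \<in> I}" "b \<in> {a \<in> carrier R. zar_of R a \<in> I}"
    then have ab: "a \<in> carrier R" "b \<in> carrier R" "zar_of R a \<in> I" "zar_of R b \<in> I" by auto
    \<comment> \<open>This expresses that the class of a sum lies below the join of the classes, in
      the form of a meet because \<open>lat_ideal\<close> states downward closure through
      meets.\<close>
    have "zar_of R (a \<oplus> b) = (zar_of R a \<squnion>\<^bsub>Zar R\<^esub> zar_of R b) \<sqinter>\<^bsub>Zar R\<^esub> zar_of R (a \<oplus> b)"
      using ab(1,2) additive_subgroup.a_closed[OF ideal.axioms(1)[OF primeideal.axioms(1)]]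
      by (intro Zar_eqI_primeideals) (auto simp: Zar_closed Zar_subset_primeideal_iff)
    then show "a \<oplus> b \<in> {a \<in> carrier R. zar_of R a \<in> I}"
      using ab join meet zar_of_closed by (metis (mono_tags, lifting) a_closed mem_Collect_eq)
  qed auto
  fix a x assume "a \<in> {a \<in> carrier R. zar_of R a \<in> I}" "x \<in> carrier R"
  then show "x \<otimes> a \<in> {a \<in> carrier R. zar_of R a \<in> I}" "a \<otimes> x \<in> {a \<in> carrier R. zar_of R a \<in> I}"
    using mult[of a x] by (simp_all add: m_comm[of x a])
qed

text \<open>Classes turn products into meets. Like the pullback of a lattice ideal above, this
  extends a refinement from \<open>U i\<close> to the whole monoid it generates.\<close>

lemma lat_filter_zar_of_submonoid:
  assumes F: "lat_filter (Zar R) F"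
  shows "submonoid {a \<in> carrier R. zar_of R a \<in> F} R"
proof
  show "\<one> \<in> {a \<in> carrier R. zar_of R a \<in> F}"
    using F by (simp add: lat_filter_def zar_of_one)
  fix a b assume "a \<in> {a \<in> carrier R. zar_of R a \<in> F}" "b \<in> {a \<in> carrier R. zar_of R a \<in> F}"
  then have ab: "a \<in> carrier R" "b \<in> carrier R" "zar_of R a \<in> F" "zar_of R b \<in> F" by auto
  then show "a \<otimes> b \<in> {a \<in> carrier R. zar_of R a \<in> F}"
    using F by (simp add: lat_filter_def zar_of_mult)
qed auto

text \<open>The extra value \<open>e (l + 1) = \<one>\<close> gives the innermost sum \<open>u l + j l\<close> the shape of the
  other steps.\<close>

lemma chain_expr_partial:
  assumes "\<forall>i\<le>l. j i \<in> carrier R \<and> u i \<in> carrier R"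
  shows "\<exists>e. e 0 = chain_expr R l j u \<and> e (Suc l) = \<one> \<and>
    (\<forall>i\<le>Suc l. e i \<in> carrier R) \<and> (\<forall>i\<le>l. e i = u i \<otimes> e (Suc i) \<oplus> j i)"
  using assms
proof (induction l arbitrary: j u)
  case 0
  then show ?case
    \<comment> \<open>Only the value at \<open>0\<close> is an actual sum; all later values are
      one.\<close>
    by (intro exI[of _ "case_nat (u 0 \<oplus> j 0) (\<lambda>_. \<one>)"]) (auto split: nat.split)
next
  case (Suc l)
  have "\<forall>i\<le>l. j (Suc i) \<in> carrier R \<and> u (Suc i) \<in> carrier R" using Suc.prems by simp
  from Suc.IH[OF this] obtain e where e: "e 0 = chain_expr R l (\<lambda>i. j (Suc i)) (\<lambda>i. u (Suc i))"
    "e (Suc l) = \<one>" "\<forall>i\<le>Suc l. e i \<in> carrier R"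
    "\<forall>i\<le>l. e i = u (Suc i) \<otimes> e (Suc i) \<oplus> j (Suc i)" by blast
  let ?e = "case_nat (u 0 \<otimes> e 0 \<oplus> j 0) e"
  have "?e i \<in> carrier R" if "i \<le> Suc (Suc l)" for i
    using that e(3) Suc.prems by (cases i) auto
  moreover have "?e i = u i \<otimes> ?e (Suc i) \<oplus> j i" if "i \<le> Suc l" for i
  proof (cases i)
    case (Suc k)
    with that have "k \<le> l" by simp
    with e(4) show ?thesis unfolding Suc nat.case by blast
  qed simp
  ultimately show ?case
    using e(1,2) by (intro exI[of _ ?e] conjI allI impI) simp_all
qed

lemma ring_collapses_imp_partial:
  assumes chain: "idealistic_chain R l J U" and "ring_collapses R l J U"
  obtains e j u where "e 0 = \<zero>" "e (Suc l) = \<one>" "\<forall>i\<le>Suc l. e i \<in> carrier R"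
    "\<forall>i\<le>l. e i = u i \<otimes> e (Suc i) \<oplus> j i"
    "\<forall>i\<le>l. j i \<in> Idl (J i) \<and> u i \<in> gen_submonoid R (U i)"
proof -
  from assms(2) obtain j u where ju: "\<forall>i\<le>l. j i \<in> Idl (J i) \<and> u i \<in> gen_submonoid R (U i)"
    "chain_expr R l j u = \<zero>" by (auto simp: ring_collapses_def)
  have "j i \<in> carrier R \<and> u i \<in> carrier R" if i: "i \<le> l" for i
  proof -
    have "J i \<subseteq> carrier R" "U i \<subseteq> carrier R"
      using chain i by (simp_all add: idealistic_chain_def)
    then show ?thesis
      using Idl_subset_carrier gen_submonoid_subset_carrier ju(1) i by blast
  qed
  then obtain e where "e 0 = chain_expr R l j u" "e (Suc l) = \<one>" "\<forall>i\<le>Suc l. e i \<in> carrier R"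
    "\<forall>i\<le>l. e i = u i \<otimes> e (Suc i) \<oplus> j i" using chain_expr_partial by blast
  then show thesis using ju by (intro that[of e u j]) simp_all
qed

text \<open>Since \<open>u \<otimes> d\<close> is the difference of the sum and \<open>a\<close>,
  the meet of the classes of \<open>u\<close> and \<open>d\<close> lies below the join of the
  classes of the sum and \<open>a\<close>. That join is therefore in \<open>F\<close>, and conjugacy
  removes the class of \<open>a\<close>, which is in \<open>I\<close>.\<close>

lemma conjugate_zar_of_step:
  assumes F: "lat_filter (Zar R) F" and con: "conjugate (Zar R) I F"
    and R: "u \<in> carrier R" "d \<in> carrier R" "a \<in> carrier R"
    and mem: "zar_of R u \<in> F" "zar_of R d \<in> F" "zar_of R a \<in> I"
  shows "zar_of R (u \<otimes> d \<oplus> a) \<in> F"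
proof -
  let ?e = "u \<otimes> d \<oplus> a"
  have "u \<in> P \<or> d \<in> P" if P: "primeideal P R" and "?e \<in> P" "a \<in> P" for P
  proof -
    interpret P: primeideal P R by fact
    have "?e \<ominus> a \<in> P" using that(2,3) by (simp add: a_minus_def)
    moreover have "?e \<ominus> a = u \<otimes> d" using R by (simp add: a_minus_def a_assoc r_neg)
    ultimately show ?thesis using P.I_prime R by simp
  qed
  then have "zar_of R ?e \<squnion>\<^bsub>Zar R\<^esub> zar_of R a =
      (zar_of R u \<sqinter>\<^bsub>Zar R\<^esub> zar_of R d) \<squnion>\<^bsub>Zar R\<^esub> (zar_of R ?e \<squnion>\<^bsub>Zar R\<^esub> zar_of R a)"
    using R by (intro Zar_eqI_primeideals) (auto simp: Zar_closed Zar_subset_primeideal_iff)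
  also have "\<dots> \<in> F"
    using F mem(1,2) R by (simp add: lat_filter_def Zar_closed)
  finally have "zar_of R ?e \<squnion>\<^bsub>Zar R\<^esub> zar_of R a \<in> F" .
  moreover have "zar_of R ?e \<in> carrier (Zar R)" using R by (simp add: zar_of_closed)
  ultimately show ?thesis
    using con mem(3) unfolding conjugate_def by blast
qed

text \<open>The class of \<open>e (l + 1)\<close> is top; the step lemma and the inclusions of the
  filters carry the classes down to \<open>e 0\<close>, so bottom lies in \<open>F 0\<close>.
  Conjugacy then fills \<open>I 0\<close>, the increasing ideals fill every \<open>I i\<close>, and
  conjugacy once more fills every \<open>F i\<close>.\<close>

lemma ring_collapses_imp_lat_collapses:
  assumes chain: "idealistic_chain R l J U" and col: "ring_collapses R l J U"
  shows "lat_collapses (Zar R) l (\<lambda>i. zar_of R ` J i) (\<lambda>i. zar_of R ` U i)"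
  unfolding lat_collapses_def
proof (intro allI impI)
  fix I F i
  assume *: "saturated (Zar R) l I F \<and> refines l I F (\<lambda>i. zar_of R ` J i) (\<lambda>i. zar_of R ` U i)"
    and i: "i \<le> l"
  have I: "lat_ideal (Zar R) (I i)" and F: "lat_filter (Zar R) (F i)"
    and con: "conjugate (Zar R) (I i) (F i)" if "i \<le> l" for i
    using * that by (simp_all add: saturated_def)
  have mono: "I i \<subseteq> I (Suc i)" "F (Suc i) \<subseteq> F i" if "i < l" for i
    using * that by (simp_all add: saturated_def)
  have ref: "zar_of R ` J i \<subseteq> I i" "zar_of R ` U i \<subseteq> F i" if "i \<le> l" for i
    using * that by (simp_all add: refines_def)
  have JU: "J i \<subseteq> carrier R" "U i \<subseteq> carrier R" if "i \<le> l" for i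
    using chain that by (simp_all add: idealistic_chain_def)
  obtain e j u where e: "e 0 = \<zero>" "e (Suc l) = \<one>" "\<forall>i\<le>Suc l. e i \<in> carrier R"
    "\<forall>i\<le>l. e i = u i \<otimes> e (Suc i) \<oplus> j i"
    and ju: "\<forall>i\<le>l. j i \<in> Idl (J i) \<and> u i \<in> gen_submonoid R (U i)"
    by (rule ring_collapses_imp_partial[OF chain col])
  have j': "j i \<in> carrier R" "zar_of R (j i) \<in> I i" if i: "i \<le> l" for i
  proof -
    have "Idl (J i) \<subseteq> {a \<in> carrier R. zar_of R a \<in> I i}"
      using ref(1)[OF i] JU(1)[OF i] by (intro genideal_minimal lat_ideal_zar_of_ideal I i) auto
    then show "j i \<in> carrier R" "zar_of R (j i) \<in> I i" using ju i by auto
  qed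
  have u': "u i \<in> carrier R" "zar_of R (u i) \<in> F i" if i: "i \<le> l" for i
  proof -
    have "gen_submonoid R (U i) \<subseteq> {a \<in> carrier R. zar_of R a \<in> F i}"
      using ref(2)[OF i] JU(2)[OF i]
      by (intro gen_submonoid_minimal lat_filter_zar_of_submonoid F i) auto
    then show "u i \<in> carrier R" "zar_of R (u i) \<in> F i" using ju i by auto
  qed
  have descend: "zar_of R (e i) \<in> F i" if i: "i \<le> l" and "zar_of R (e (Suc i)) \<in> F i" for i
  proof -
    have "e (Suc i) \<in> carrier R" "e i = u i \<otimes> e (Suc i) \<oplus> j i" using e(3,4) i by auto
    then show ?thesis
      using conjugate_zar_of_step[OF F[OF i] con[OF i] u'(1)[OF i] _ j'(1)[OF i] u'(2)[OF i]
          that(2) j'(2)[OF i]] by simp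
  qed
  have top: "\<top>\<^bsub>Zar R\<^esub> \<in> F i" if "i \<le> l" for i
    using F[OF that] by (simp add: lat_filter_def)
  have "zar_of R (e i) \<in> F i" if "i \<le> l" for i
    using that
  proof (induction i rule: inc_induct)
    case base
    show ?case
      using top[of l] e(2) by (intro descend) (simp_all add: zar_of_one)
  next
    case (step n)
    then show ?case using mono(2)[of n] descend[of n] by auto
  qed
  from this[of 0] have bot: "\<bottom>\<^bsub>Zar R\<^esub> \<in> F 0" using e(1) by (simp add: zar_of_zero)
  have "carrier (Zar R) \<subseteq> I 0"
  proof
    fix x assume x: "x \<in> carrier (Zar R)"
    then have "x \<sqinter>\<^bsub>Zar R\<^esub> \<bottom>\<^bsub>Zar R\<^esub> = \<bottom>\<^bsub>Zar R\<^esub>"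
      by (intro Zar_eqI_primeideals) (simp_all add: Zar_closed Zar_subset_primeideal_iff)
    moreover have "\<bottom>\<^bsub>Zar R\<^esub> \<in> I 0" using I[of 0] by (simp add: lat_ideal_def)
    ultimately show "x \<in> I 0"
      using con[of 0] x bot unfolding conjugate_def by (metis le0)
  qed
  then have "carrier (Zar R) \<subseteq> I i"
    using i
  proof (induction i)
    case (Suc i)
    then show ?case using mono(1)[of i] by auto
  qed simp
  then have I_eq: "I i = carrier (Zar R)"
    using I[OF i] by (auto simp: lat_ideal_def)
  \<comment> \<open>Top is now in \<open>I i\<close> as well as in \<open>F i\<close>, so conjugacy
    applies with \<open>j\<close> equal to top.\<close>
  have "x \<in> F i" if x: "x \<in> carrier (Zar R)" for x
  proof -
    have "x \<squnion>\<^bsub>Zar R\<^esub> \<top>\<^bsub>Zar R\<^esub> = \<top>\<^bsub>Zar R\<^esub>"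
      using x by (intro Zar_eqI_primeideals) (simp_all add: Zar_closed Zar_subset_primeideal_iff)
    then show ?thesis
      using con[OF i] x top[OF i] I_eq Zar_top_closed unfolding conjugate_def by metis
  qed
  then show "I i = carrier (Zar R) \<and> F i = carrier (Zar R)"
    using I_eq F[OF i] by (auto simp: lat_filter_def)
qed

section \<open>The entailment system\<close>

text \<open>One clause per index and prime; the guards \<open>0 < i\<close> and \<open>i < l\<close>
  stand for the absent ends \<open>x 0\<close> and \<open>x (l + 1)\<close>.\<close>

lemma entailment_system_Zar_iff_primeideals:
  assumes chain: "idealistic_chain R l J U" and fin: "\<forall>i\<le>l. finite (J i) \<and> finite (U i)"
    and x: "\<forall>i\<in>{1..l}. x i \<in> carrier (Zar R)"
  shows "entailment_system (Zar R) l (\<lambda>i. zar_of R ` J i) (\<lambda>i. zar_of R ` U i) x \<longleftrightarrow>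
    (\<forall>i\<le>l. \<forall>P. primeideal P R \<longrightarrow> J i \<subseteq> P \<longrightarrow> (0 < i \<longrightarrow> x i \<subseteq> P) \<longrightarrow>
      (i < l \<and> x (Suc i) \<subseteq> P) \<or> U i \<inter> P \<noteq> {})"
  unfolding entailment_system_def
proof (intro all_cong)
  fix i assume i: "i \<le> l"
  let ?A = "(if i < l then {x (Suc i)} else {}) \<union> zar_of R ` U i"
  let ?B = "zar_of R ` J i \<union> (if 0 < i then {x i} else {})"
  have J: "J i \<subseteq> carrier R" and U: "U i \<subseteq> carrier R"
    using chain i by (simp_all add: idealistic_chain_def)
  have A: "finite ?A" "?A \<subseteq> carrier (Zar R)"
    using fin x i U by (auto simp: zar_of_closed)
  have B: "finite ?B" "?B \<subseteq> carrier (Zar R)"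
    using fin x i J by (auto simp: zar_of_closed)
  have "(\<exists>a\<in>?A. a \<subseteq> P) \<longleftrightarrow> (i < l \<and> x (Suc i) \<subseteq> P) \<or> U i \<inter> P \<noteq> {}"
    "(\<forall>b\<in>?B. b \<subseteq> P) \<longleftrightarrow> J i \<subseteq> P \<and> (0 < i \<longrightarrow> x i \<subseteq> P)" if P: "primeideal P R" for P
  proof -
    have iff: "zar_of R a \<subseteq> P \<longleftrightarrow> a \<in> P" if "a \<in> J i \<union> U i" for a
      using that J U P by (intro zar_of_subset_primeideal_iff) auto
    have "(\<exists>a\<in>zar_of R ` U i. a \<subseteq> P) \<longleftrightarrow> U i \<inter> P \<noteq> {}" "(\<forall>b\<in>zar_of R ` J i. b \<subseteq> P) \<longleftrightarrow> J i \<subseteq> P"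
      using iff by (simp_all add: disjoint_iff subset_iff[of "J i"]) blast+
    then show "(\<exists>a\<in>?A. a \<subseteq> P) \<longleftrightarrow> (i < l \<and> x (Suc i) \<subseteq> P) \<or> U i \<inter> P \<noteq> {}"
      "(\<forall>b\<in>?B. b \<subseteq> P) \<longleftrightarrow> J i \<subseteq> P \<and> (0 < i \<longrightarrow> x i \<subseteq> P)"
      by (simp_all add: bex_Un ball_Un)
  qed
  then show "entails (Zar R) ?A ?B \<longleftrightarrow> (\<forall>P. primeideal P R \<longrightarrow> J i \<subseteq> P \<longrightarrow> (0 < i \<longrightarrow> x i \<subseteq> P) \<longrightarrow>
      (i < l \<and> x (Suc i) \<subseteq> P) \<or> U i \<inter> P \<noteq> {})"
    unfolding entails_Zar_iff_primeideals[OF A B] by (intro all_cong1) (auto simp del: subset_iff)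
qed

text \<open>At a prime containing \<open>J i\<close> and \<open>e i\<close>, the difference
  \<open>u i \<otimes> e (i + 1)\<close> of \<open>e i\<close> and \<open>j i\<close> lies in the
  prime. If \<open>U i\<close> misses the prime, so does \<open>u i\<close>, and
  \<open>e (i + 1)\<close> must be in it.\<close>

lemma ring_collapses_imp_entailment_system:
  assumes chain: "idealistic_chain R l J U" and fin: "\<forall>i\<le>l. finite (J i) \<and> finite (U i)"
    and col: "ring_collapses R l J U"
  shows "\<exists>x. (\<forall>i\<in>{1..l}. x i \<in> zar_of R ` carrier R) \<and>
    entailment_system (Zar R) l (\<lambda>i. zar_of R ` J i) (\<lambda>i. zar_of R ` U i) x"
proof -
  obtain e j u where e: "e 0 = \<zero>" "e (Suc l) = \<one>" "\<forall>i\<le>Suc l. e i \<in> carrier R"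
    "\<forall>i\<le>l. e i = u i \<otimes> e (Suc i) \<oplus> j i"
    and ju: "\<forall>i\<le>l. j i \<in> Idl (J i) \<and> u i \<in> gen_submonoid R (U i)"
    by (rule ring_collapses_imp_partial[OF chain col])
  let ?x = "\<lambda>i. zar_of R (e i)"
  have "(i < l \<and> ?x (Suc i) \<subseteq> P) \<or> U i \<inter> P \<noteq> {}"
    if i: "i \<le> l" and P: "primeideal P R" and JP: "J i \<subseteq> P" and xP: "0 < i \<longrightarrow> ?x i \<subseteq> P" for i P
  proof (rule ccontr)
    assume neg: "\<not> ?thesis"
    interpret P: primeideal P R by fact
    have J: "J i \<subseteq> carrier R" and U: "U i \<subseteq> carrier R"
      using chain i by (simp_all add: idealistic_chain_def)
    have eR: "e i \<in> carrier R" "e (Suc i) \<in> carrier R" using e(3) i by auto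
    have j: "j i \<in> P"
      using genideal_minimal[OF P.is_ideal JP] ju i by blast
    have "gen_submonoid R (U i) \<subseteq> carrier R - P"
      using neg U by (intro gen_submonoid_minimal primeideal_compl_submonoid P) auto
    then have u: "u i \<in> carrier R" "u i \<notin> P" using ju i by auto
    \<comment> \<open>For \<open>i = 0\<close> the hypothesis \<open>xP\<close> is void, but
      \<open>e 0\<close> is zero.\<close>
    have "e i \<in> P"
      using xP e(1) eR zar_of_subset_primeideal_iff[OF _ P] P.zero_closed by (cases "i = 0") auto
    with j have "e i \<ominus> j i \<in> P" by (simp add: a_minus_def)
    moreover have "e i \<ominus> j i = u i \<otimes> e (Suc i)"
      using e(4) i u(1) eR(2) P.Icarr[OF j] by (simp add: a_minus_def a_assoc r_neg)
    ultimately have eP: "e (Suc i) \<in> P"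
      using u eR(2) by (simp add: primeideal_mult_iff[OF P])
    \<comment> \<open>At \<open>i = l\<close> the next value is one, which no prime
      contains.\<close>
    then have "i \<noteq> l" using e(2) primeideal_one[OF P] by auto
    with i eP eR(2) neg show False by (simp add: zar_of_subset_primeideal_iff[OF _ P])
  qed
  moreover have "\<forall>i\<in>{1..l}. ?x i \<in> carrier (Zar R)" using e(3) by (simp add: zar_of_closed)
  ultimately have "entailment_system (Zar R) l (\<lambda>i. zar_of R ` J i) (\<lambda>i. zar_of R ` U i) ?x"
    unfolding entailment_system_Zar_iff_primeideals[OF chain fin \<open>\<forall>i\<in>{1..l}. ?x i \<in> carrier (Zar R)\<close>]
    by blast
  then show ?thesis using e(3) by (intro exI[of _ ?x]) auto
qed

text \<open>Along a chain of primes witnessing that there is no collapse, each clause at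
  \<open>p i\<close> forces \<open>x (i + 1)\<close> into \<open>p i\<close> and thus into
  \<open>p (i + 1)\<close>. At \<open>i = l\<close> there is no further unknown, a
  contradiction.\<close>

lemma entailment_system_imp_ring_collapses:
  assumes chain: "idealistic_chain R l J U" and fin: "\<forall>i\<le>l. finite (J i) \<and> finite (U i)"
    and x: "\<forall>i\<in>{1..l}. x i \<in> carrier (Zar R)"
    and sys: "entailment_system (Zar R) l (\<lambda>i. zar_of R ` J i) (\<lambda>i. zar_of R ` U i) x"
  shows "ring_collapses R l J U"
proof (rule ccontr)
  assume "\<not> ?thesis"
  with chain obtain p where p: "\<forall>i\<le>l. primeideal (p i) R \<and> J i \<subseteq> p i \<and> U i \<inter> p i = {}"
    "\<forall>i<l. p i \<subseteq> p (Suc i)"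
    by (rule not_ring_collapses_imp_prime_chain)
  have step: "i < l \<and> x (Suc i) \<subseteq> p i" if "i \<le> l" "0 < i \<longrightarrow> x i \<subseteq> p i" for i
    using sys that p(1) unfolding entailment_system_Zar_iff_primeideals[OF chain fin x] by blast
  have "0 < i \<longrightarrow> x i \<subseteq> p i" if "i \<le> l" for i
    using that
  proof (induction i)
    case (Suc i)
    then have "x (Suc i) \<subseteq> p i" using step[of i] by simp
    moreover have "p i \<subseteq> p (Suc i)" using p(2) Suc.prems by simp
    ultimately show ?case by blast
  qed simp
  then show False using step[of l] by simp
qed

end

theorem theorem3p4:
  fixes R :: "('a, 'm) ring_scheme" and l :: nat and J U :: "nat \<Rightarrow> 'a set"
  assumes "cring R" and "idealistic_chain R l J U"
  shows
    "(ring_collapses R l J U \<longleftrightarrow>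
        lat_collapses (Zar R) l (\<lambda>i. zar_of R ` J i) (\<lambda>i. zar_of R ` U i))
     \<and>
     ((\<forall>i\<le>l. finite (J i) \<and> finite (U i)) \<longrightarrow>
        ((\<exists>j u. (\<forall>i\<le>l. j i \<in> Idl\<^bsub>R\<^esub> (J i) \<and> u i \<in> gen_submonoid R (U i)) \<and>
                chain_expr R l j u = \<zero>\<^bsub>R\<^esub>)
         \<longleftrightarrow>
         (\<exists>x. (\<forall>i\<in>{1..l}. x i \<in> carrier (Zar R)) \<and>
              entailment_system (Zar R) l (\<lambda>i. zar_of R ` J i) (\<lambda>i. zar_of R ` U i) x))
        \<and>
        ((\<exists>x. (\<forall>i\<in>{1..l}. x i \<in> carrier (Zar R)) \<and>
              entailment_system (Zar R) l (\<lambda>i. zar_of R ` J i) (\<lambda>i. zar_of R ` U i) x)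
         \<longleftrightarrow>
         (\<exists>x. (\<forall>i\<in>{1..l}. x i \<in> zar_of R ` carrier R) \<and>
              entailment_system (Zar R) l (\<lambda>i. zar_of R ` J i) (\<lambda>i. zar_of R ` U i) x)))"
proof -
  interpret cring R by fact
  note chain = assms(2)
  let ?J = "\<lambda>i. zar_of R ` J i" and ?U = "\<lambda>i. zar_of R ` U i"
  have zar: "\<forall>i\<in>{1..l}. x i \<in> carrier (Zar R)" if "\<forall>i\<in>{1..l}. x i \<in> zar_of R ` carrier R" for x
    using that zar_of_closed by auto
  have "ring_collapses R l J U \<longleftrightarrow> lat_collapses (Zar R) l ?J ?U"
    using ring_collapses_imp_lat_collapses[OF chain] lat_collapses_imp_ring_collapses[OF chain]
    by (rule iffI)
  \<comment> \<open>A collapse yields a solution in the classes of elements of \<open>R\<close>,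
    which is a solution in \<open>Zar R\<close>, which in turn yields a collapse.\<close>
  moreover have "ring_collapses R l J U \<longleftrightarrow>
      (\<exists>x. (\<forall>i\<in>{1..l}. x i \<in> carrier (Zar R)) \<and> entailment_system (Zar R) l ?J ?U x)"
    "(\<exists>x. (\<forall>i\<in>{1..l}. x i \<in> carrier (Zar R)) \<and> entailment_system (Zar R) l ?J ?U x) \<longleftrightarrow>
      (\<exists>x. (\<forall>i\<in>{1..l}. x i \<in> zar_of R ` carrier R) \<and> entailment_system (Zar R) l ?J ?U x)"
    if fin: "\<forall>i\<le>l. finite (J i) \<and> finite (U i)"
    using ring_collapses_imp_entailment_system[OF chain fin]
      entailment_system_imp_ring_collapses[OF chain fin] zar by blast+
  ultimately show ?thesis
    unfolding ring_collapses_def[symmetric] by blast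
qed

end
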